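(* Let $(\mathcal{E},\mathbf{P},T)$ be a pre-evolution over $\mathcal{J}$. Suppose that $T=\{T_\tau\}_{\tau\in\mathcal{J}}$ is $k_{\mathrm{SOT}}$-continuous in the index set and that $\mathcal{J}$ is compact. Then there exists a quantum process $(\tilde{\mathcal{E}},\mathbf{P},\mathcal{P},U)$ continuously monitored via passive measurements such that the evolution problem for $(\mathcal{E},\mathbf{P},T)$ reduces to the monitoring problem for $(\tilde{\mathcal{E}},\mathbf{P},\mathcal{P},U)$, i.e. the former has a positive solution if and only if the latter does. If both problems are positively solved, then the limits satisfy $$\mathcal{T}(t,s)=j\,(\mathcal{P}\ltimes U)(t,s)\,r,\qquad(\mathcal{P}\ltimes U)(t,s)=r\,\mathcal{T}(t,s)\,j_s$$ for all $(t,s)\in\Delta$, where $r\in\mathcal{L}(\mathcal{E},\tilde{\mathcal{E}})$ is an isometric embedding and $j,\,j_s\in\mathcal{L}(\tilde{\mathcal{E}},\mathcal{E})$ are surjective isometries with $j\,r=j_s\,r=\mathbf{1}$ for $s\in\mathcal{J}$.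
   Context: Standing notation. $\mathcal{J}\subseteq\mathbb{R}$ is a connected subset and $\Delta=\{(t,s)\in\mathcal{J}^2: t\ge s\}$. $\mathcal{L}(\mathcal{E},\mathcal{F})$ denotes bounded linear operators between Banach spaces, and $\mathcal{L}(\mathcal{E})=\mathcal{L}(\mathcal{E},\mathcal{E})$. Partitions. Let $\mathcal{F}_{[0,1]}$ be the set of finite $\Xi\subseteq[0,1]$ with $\min\Xi=0$, $\max\Xi=1$; put $N(\Xi)=|\Xi|-1$ and enumerate $\Xi$ as $0=\tau_0^\Xi<\tau_1^\Xi<\dots<\tau_{N(\Xi)}^\Xi=1$. For $t\ge s$ put $\tau_k^{\Xi(t,s)}=s+(t-s)\tau_k^\Xi$ ($0\le k\le N(\Xi)$) and $\delta\tau_k^{\Xi(t,s)}=\tau_k^{\Xi(t,s)}-\tau_{k-1}^{\Xi(t,s)}$ ($1\le k\le N(\Xi)$). A non-empty $\mathbf{P}\subseteq\mathcal{F}_{[0,1]}$ is a self-similar system of partitions if for all $\Xi\in\mathbf{P}$ and $\alpha\in[0,1]$ there are $\Gamma_1,\Gamma_2,\Gamma_3\in\mathbf{P}$ with $\Gamma_3=(\alpha\Gamma_1)\cup(\alpha+(1-\alpha)\Gamma_2)\supseteq\Xi$. Such a $\mathbf{P}$ is directed by $\supseteq$ (finer partitions are later), and limits over $\Xi\in\mathbf{P}$ are taken with respect to this direction. Convergence. For operator-valued functions on $\Delta$, $F^{\Xi}\to F$ in $k_{\mathrm{SOT}}$ means $\sup_{(t,s)\in K}\|(F^\Xi(t,s)-F(t,s))\xi\|\to0$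 for all compact $K\subseteq\Delta$ and all vectors $\xi$. Write $\mathrm{rev}\text{-}\prod_{k=1}^nA_k=A_n\cdots A_2A_1$. Evolution problem. A pre-evolution $(\mathcal{E},\mathbf{P},T)$ consists of a Banach space $\mathcal{E}$, a self-similar system of partitions $\mathbf{P}$, and a family $T=\{T_\tau\}_{\tau\in\mathcal{J}}$ of contractive $C_0$-semigroups on $\mathcal{E}$. Put $\mathcal{T}^\Xi(t,s)=\mathrm{rev}\text{-}\prod_{k=1}^{N(\Xi)}T_{\tau_k^{\Xi(t,s)}}(\delta\tau_k^{\Xi(t,s)})$ for $(t,s)\in\Delta$. The evolution problem has a positive solution if there is $\mathcal{T}:\Delta\to\mathcal{L}(\mathcal{E})$ with $\mathcal{T}^\Xi\to\mathcal{T}$ in $k_{\mathrm{SOT}}$, the limit taken over $\Xi\in\mathbf{P}$; $\mathcal{T}$ is then called the limit. $T$ is $k_{\mathrm{SOT}}$-continuous in the index set if for all $\tau_0\in\mathcal{J}$, compact $K\subseteq\mathbb{R}_{\ge0}$, $\xi\in\mathcal{E}$: $\sup_{t\in K}\|(T_\tau(t)-T_{\tau_0}(t))\xi\|\to0$ as $\tau\to\tau_0$. Monitoring problem. Let $\mathcal{X}=\{X_\tau\}_{\tau\in\mathcal{J}}$ be a strongly continuous family of contractions on a Banach space $\tilde{\mathcal{E}}$ and let $S$ be a contractive $C_0$-semigroup on $\tilde{\mathcal{E}}$. Put $(\mathcal{X}\ltimes S)^\Xi(t,s)=\mathrm{rev}\text{-}\prod_{k=1}^{N(\Xi)}X_{\tau_k^{\Xi(t,s)}}S(\delta\tau_k^{\Xi(t,s)})$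 for $(t,s)\in\Delta$. The monitoring problem for $(\tilde{\mathcal{E}},\mathbf{P},\mathcal{X},S)$ has a positive solution if there is $\mathcal{X}\ltimes S:\Delta\to\mathcal{L}(\tilde{\mathcal{E}})$ (the limit) with $(\mathcal{X}\ltimes S)^\Xi\to\mathcal{X}\ltimes S$ in $k_{\mathrm{SOT}}$ over $\Xi\in\mathbf{P}$. A quantum process continuously monitored via passive measurements is such a datum $(\tilde{\mathcal{E}},\mathbf{P},\mathcal{P},U)$ where: $S=U|_{\mathbb{R}_{\ge0}}$ for a strongly continuous group representation $U$ of $\mathbb{R}$ on $\tilde{\mathcal{E}}$ by surjective isometries; and $\mathcal{X}=\mathcal{P}=\{P_\tau\}_{\tau\in\mathcal{J}}$ is a (strongly continuous) family of contractions satisfying $P_\sigma P_\tau=P_\tau$ for all $\sigma,\tau\in\mathcal{J}$ (family of measurements) and such that for each $\tau$ the family $\{P_\tau U(t)P_\tau\}_{t\ge0}$ satisfies the semigroup law $P_\tau U(s)P_\tau\cdot P_\tau U(t)P_\tau=P_\tau U(s+t)P_\tau$ (passivity). One writes $\mathcal{P}\ltimes U$ for $\mathcal{P}\ltimes U|_{\mathbb{R}_{\ge0}}$.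
   Formalization: The "surjective isometries" j, j_s are taken as metric surjections (the norm of y is the infimum of the norms of its preimages), not norm-preserving maps; with norm-preserving maps the claim fails, e.g. for scalars with T_τ(t)=e^{-t} on [0,1]. *)

theory Defs
  imports "HOL-Analysis.Analysis"
begin

section \<open>Banach spaces and bounded operators\<close>

text \<open>
  HOL cannot quantify existentially over types inside a theorem. So that a Banach space can be an
  object of the logic, it is given as a complete linear subspace \<open>pts\<close> of a type of class
  \<^class>\<open>real_normed_vector\<close>, carrying the norm of that type; a type of class \<^class>\<open>banach\<close> is the
  case \<open>pts = UNIV\<close>.
  The scalars are an arbitrary \<^class>\<open>real_normed_field\<close>, which covers both the reals
  (with \<open>smul = scaleR\<close>) and the complex numbers. Operators are total functions of which only the
  restriction to \<open>pts\<close> matters; accordingly they are only ever compared on \<open>pts\<close>.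
\<close>

record ('k, 'v) nspace =
  pts :: "'v set"
  smul :: "'k \<Rightarrow> 'v \<Rightarrow> 'v"

definition banach_space :: "('k::real_normed_field, 'v::real_normed_vector) nspace \<Rightarrow> bool" where
  "banach_space V \<longleftrightarrow>
     vector_space (smul V) \<and>
     (\<forall>a x. smul V (of_real a) x = a *\<^sub>R x) \<and>
     (\<forall>c x. norm (smul V c x) = norm c * norm x) \<and>
     module.subspace (smul V) (pts V) \<and> complete (pts V)"

definition bounded_ops ::
  "('k::real_normed_field, 'v::real_normed_vector) nspace \<Rightarrow> ('k, 'w::real_normed_vector) nspace \<Rightarrow> ('v \<Rightarrow> 'w) set" where
  "bounded_ops V W = {A.
     (\<forall>x\<in>pts V. A x \<in> pts W) \<and>
     (\<forall>x\<in>pts V. \<forall>y\<in>pts V. A (x + y) = A x + A y) \<and>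
     (\<forall>c. \<forall>x\<in>pts V. A (smul V c x) = smul W c (A x)) \<and>
     (\<exists>B. \<forall>x\<in>pts V. norm (A x) \<le> B * norm x)}"

definition contraction :: "('k::real_normed_field, 'v::real_normed_vector) nspace \<Rightarrow> ('v \<Rightarrow> 'v) \<Rightarrow> bool" where
  "contraction V A \<longleftrightarrow> A \<in> bounded_ops V V \<and> (\<forall>x\<in>pts V. norm (A x) \<le> norm x)"

definition isometric_embedding ::
  "('k::real_normed_field, 'v::real_normed_vector) nspace \<Rightarrow> ('k, 'w::real_normed_vector) nspace \<Rightarrow> ('v \<Rightarrow> 'w) \<Rightarrow> bool" where
  "isometric_embedding V W r \<longleftrightarrow> r \<in> bounded_ops V W \<and> (\<forall>x\<in>pts V. norm (r x) = norm x)"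

text \<open>
  A surjective isometry in the sense of metric surjections (co-isometries): the norm of \<open>W\<close> is the
  quotient norm, i.e. the map induced on the quotient of \<open>V\<close> by the kernel is a surjective isometry
  onto \<open>W\<close>. Injectivity is deliberately not required: a norm-preserving surjection \<open>j\<close> with
  \<open>j \<circ> r = id\<close> would make \<open>r\<close> an isomorphism.
\<close>

definition surjective_isometry ::
  "('k::real_normed_field, 'v::real_normed_vector) nspace \<Rightarrow> ('k, 'w::real_normed_vector) nspace \<Rightarrow> ('v \<Rightarrow> 'w) \<Rightarrow> bool" where
  "surjective_isometry V W j \<longleftrightarrow>
     j \<in> bounded_ops V W \<and> j ` pts V = pts W \<and>
     (\<forall>y\<in>pts W. norm y = Inf (norm ` {x \<in> pts V. j x = y}))"

section \<open>Semigroups and groups\<close>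

definition contractive_C0_semigroup ::
  "('k::real_normed_field, 'v::real_normed_vector) nspace \<Rightarrow> (real \<Rightarrow> 'v \<Rightarrow> 'v) \<Rightarrow> bool" where
  "contractive_C0_semigroup V S \<longleftrightarrow>
     (\<forall>t\<ge>0. contraction V (S t)) \<and>
     (\<forall>x\<in>pts V. S 0 x = x) \<and>
     (\<forall>s\<ge>0. \<forall>t\<ge>0. \<forall>x\<in>pts V. S (s + t) x = S s (S t x)) \<and>
     (\<forall>x\<in>pts V. continuous_on {0..} (\<lambda>t. S t x))"

definition isometric_C0_group ::
  "('k::real_normed_field, 'v::real_normed_vector) nspace \<Rightarrow> (real \<Rightarrow> 'v \<Rightarrow> 'v) \<Rightarrow> bool" where
  "isometric_C0_group V U \<longleftrightarrow>
     (\<forall>t. U t \<in> bounded_ops V V \<and> U t ` pts V = pts V \<and> (\<forall>x\<in>pts V. norm (U t x) = norm x)) \<and>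
     (\<forall>x\<in>pts V. U 0 x = x) \<and>
     (\<forall>s t. \<forall>x\<in>pts V. U (s + t) x = U s (U t x)) \<and>
     (\<forall>x\<in>pts V. continuous_on UNIV (\<lambda>t. U t x))"

section \<open>Partitions\<close>

definition partitions01 :: "real set set" where
  "partitions01 = {\<Xi>. finite \<Xi> \<and> \<Xi> \<noteq> {} \<and> \<Xi> \<subseteq> {0..1} \<and> Min \<Xi> = 0 \<and> Max \<Xi> = 1}"

definition N_part :: "real set \<Rightarrow> nat" where
  "N_part \<Xi> = card \<Xi> - 1"

definition tau :: "real set \<Rightarrow> real \<Rightarrow> real \<Rightarrow> nat \<Rightarrow> real" where
  "tau \<Xi> t s k = s + (t - s) * (sorted_list_of_set \<Xi> ! k)"

definition dtau :: "real set \<Rightarrow> real \<Rightarrow> real \<Rightarrow> nat \<Rightarrow> real" where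
  "dtau \<Xi> t s k = tau \<Xi> t s k - tau \<Xi> t s (k - 1)"

definition self_similar :: "real set set \<Rightarrow> bool" where
  "self_similar P \<longleftrightarrow>
     P \<noteq> {} \<and> P \<subseteq> partitions01 \<and>
     (\<forall>\<Xi>\<in>P. \<forall>\<alpha>\<in>{0..1}. \<exists>\<Gamma>1\<in>P. \<exists>\<Gamma>2\<in>P. \<exists>\<Gamma>3\<in>P.
        \<Gamma>3 = (\<lambda>x. \<alpha> * x) ` \<Gamma>1 \<union> (\<lambda>x. \<alpha> + (1 - \<alpha>) * x) ` \<Gamma>2 \<and> \<Gamma>3 \<supseteq> \<Xi>)"

definition refinement :: "real set set \<Rightarrow> real set filter" where
  "refinement P = (INF \<Xi>0\<in>P. principal {\<Xi>\<in>P. \<Xi>0 \<subseteq> \<Xi>})"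

lemma self_similar_directed:
  assumes P: "self_similar P" and "\<Xi> \<in> P" "\<Xi>' \<in> P"
  shows "\<exists>\<Gamma>\<in>P. \<Xi> \<subseteq> \<Gamma> \<and> \<Xi>' \<subseteq> \<Gamma>"
proof -
  have part: "finite X \<and> X \<subseteq> {0..1} \<and> 0 \<in> X" if "X \<in> P" for X
  proof -
    have X: "finite X" "X \<noteq> {}" "X \<subseteq> {0..1}" "Min X = 0"
      using that P unfolding self_similar_def partitions01_def by blast+
    moreover have "0 \<in> X" using Min_in[OF X(1,2)] X(4) by simp
    ultimately show ?thesis by blast
  qed
  have "\<exists>\<Gamma>\<in>P. \<Xi> \<subseteq> \<Gamma> \<and> S \<subseteq> \<Gamma>" if "finite S" "S \<subseteq> {0..1}" for S
    using that
  proof (induction S rule: finite_induct)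
    case empty
    show ?case using assms(2) by blast
  next
    case (insert a S)
    then obtain \<Gamma> where \<Gamma>: "\<Gamma> \<in> P" "\<Xi> \<subseteq> \<Gamma>" "S \<subseteq> \<Gamma>" by blast
    have "\<forall>\<alpha>\<in>{0..1}. \<exists>\<Gamma>1\<in>P. \<exists>\<Gamma>2\<in>P. \<exists>\<Gamma>3\<in>P.
        \<Gamma>3 = (\<lambda>x. \<alpha> * x) ` \<Gamma>1 \<union> (\<lambda>x. \<alpha> + (1 - \<alpha>) * x) ` \<Gamma>2 \<and> \<Gamma>3 \<supseteq> \<Gamma>"
      using P \<Gamma>(1) unfolding self_similar_def by (elim conjE) (erule (1) bspec)
    moreover have "a \<in> {0..1}" using insert.prems by blast
    ultimately have "\<exists>\<Gamma>1\<in>P. \<exists>\<Gamma>2\<in>P. \<exists>\<Gamma>3\<in>P.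
        \<Gamma>3 = (\<lambda>x. a * x) ` \<Gamma>1 \<union> (\<lambda>x. a + (1 - a) * x) ` \<Gamma>2 \<and> \<Gamma>3 \<supseteq> \<Gamma>"
      by (rule bspec)
    then obtain A B C where C: "A \<in> P" "B \<in> P" "C \<in> P"
        "C = (\<lambda>x. a * x) ` A \<union> (\<lambda>x. a + (1 - a) * x) ` B" "C \<supseteq> \<Gamma>"
      by (elim bexE conjE) (rule that)
    have "0 \<in> B" using part[OF C(2)] by blast
    then have "(\<lambda>x. a + (1 - a) * x) 0 \<in> (\<lambda>x. a + (1 - a) * x) ` B" by (rule imageI)
    then have "a \<in> C" unfolding C(4) by simp
    then show ?case using C(3,5) \<Gamma>(2,3) by blast
  qed
  then show ?thesis using part[OF assms(3)] by blast
qed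

lemma eventually_refinement:
  assumes "self_similar P"
  shows "eventually Q (refinement P) \<longleftrightarrow> (\<exists>\<Xi>0\<in>P. \<forall>\<Xi>\<in>P. \<Xi>0 \<subseteq> \<Xi> \<longrightarrow> Q \<Xi>)"
proof -
  have "P \<noteq> {}" using assms by (simp add: self_similar_def)
  moreover have "\<exists>\<Gamma>\<in>P. principal {\<Xi>\<in>P. \<Gamma> \<subseteq> \<Xi>}
      \<le> inf (principal {\<Xi>\<in>P. A \<subseteq> \<Xi>}) (principal {\<Xi>\<in>P. B \<subseteq> \<Xi>})"
    if "A \<in> P" "B \<in> P" for A B
  proof -
    obtain \<Gamma> where "\<Gamma> \<in> P" "A \<subseteq> \<Gamma>" "B \<subseteq> \<Gamma>"
      using self_similar_directed[OF assms \<open>A \<in> P\<close> \<open>B \<in> P\<close>] by blast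
    then show ?thesis by (intro bexI[of _ \<Gamma>]) (simp, blast, assumption)
  qed
  ultimately have "eventually Q (refinement P) \<longleftrightarrow>
      (\<exists>\<Xi>0\<in>P. eventually Q (principal {\<Xi>\<in>P. \<Xi>0 \<subseteq> \<Xi>}))"
    unfolding refinement_def by (rule eventually_INF_base)
  then show ?thesis by (simp add: eventually_principal imp_conjL Ball_def)
qed

section \<open>Limits of products along partitions\<close>

definition Delta :: "real set \<Rightarrow> (real \<times> real) set" where
  "Delta J = {(t, s). t \<in> J \<and> s \<in> J \<and> t \<ge> s}"

primrec rev_prod :: "(nat \<Rightarrow> 'v \<Rightarrow> 'v) \<Rightarrow> nat \<Rightarrow> 'v \<Rightarrow> 'v" where
  "rev_prod A 0 = id"
| "rev_prod A (Suc n) = A (Suc n) \<circ> rev_prod A n"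

text \<open>
  \<open>kSOT_limit V J P F L\<close>: \<open>L\<close> takes values in the bounded operators on \<open>V\<close>, and the net
  \<open>F \<Xi>\<close>, \<open>\<Xi> \<in> P\<close>, converges to \<open>L\<close> uniformly on compact subsets of \<open>Delta J\<close> in the strong operator
  topology.
\<close>

definition kSOT_limit ::
  "('k::real_normed_field, 'v::real_normed_vector) nspace \<Rightarrow> real set \<Rightarrow> real set set \<Rightarrow>
   (real set \<Rightarrow> real \<Rightarrow> real \<Rightarrow> 'v \<Rightarrow> 'v) \<Rightarrow> (real \<Rightarrow> real \<Rightarrow> 'v \<Rightarrow> 'v) \<Rightarrow> bool" where
  "kSOT_limit V J P F L \<longleftrightarrow>
     (\<forall>(t, s)\<in>Delta J. L t s \<in> bounded_ops V V) \<and>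
     (\<forall>K. compact K \<and> K \<subseteq> Delta J \<longrightarrow>
        (\<forall>\<xi>\<in>pts V. uniform_limit K (\<lambda>\<Xi> (t, s). F \<Xi> t s \<xi>) (\<lambda>(t, s). L t s \<xi>) (refinement P)))"

section \<open>The evolution problem\<close>

text \<open>\<open>T \<tau> t\<close> is the semigroup with index \<open>\<tau>\<close> at time \<open>t\<close>.\<close>

definition pre_evolution ::
  "('k::real_normed_field, 'v::real_normed_vector) nspace \<Rightarrow> real set \<Rightarrow> real set set \<Rightarrow>
   (real \<Rightarrow> real \<Rightarrow> 'v \<Rightarrow> 'v) \<Rightarrow> bool" where
  "pre_evolution E J P T \<longleftrightarrow>
     banach_space E \<and> self_similar P \<and> (\<forall>\<tau>\<in>J. contractive_C0_semigroup E (T \<tau>))"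

definition kSOT_index_continuous ::
  "('k::real_normed_field, 'v::real_normed_vector) nspace \<Rightarrow> real set \<Rightarrow> (real \<Rightarrow> real \<Rightarrow> 'v \<Rightarrow> 'v) \<Rightarrow> bool" where
  "kSOT_index_continuous E J T \<longleftrightarrow>
     (\<forall>\<tau>0\<in>J. \<forall>K. compact K \<and> K \<subseteq> {0..} \<longrightarrow>
        (\<forall>\<xi>\<in>pts E. uniform_limit K (\<lambda>\<tau> t. T \<tau> t \<xi>) (\<lambda>t. T \<tau>0 t \<xi>) (at \<tau>0 within J)))"

definition evolution_prod ::
  "(real \<Rightarrow> real \<Rightarrow> 'v \<Rightarrow> 'v) \<Rightarrow> real set \<Rightarrow> real \<Rightarrow> real \<Rightarrow> 'v \<Rightarrow> 'v" where
  "evolution_prod T \<Xi> t s = rev_prod (\<lambda>k. T (tau \<Xi> t s k) (dtau \<Xi> t s k)) (N_part \<Xi>)"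

definition evolution_limit ::
  "('k::real_normed_field, 'v::real_normed_vector) nspace \<Rightarrow> real set \<Rightarrow> real set set \<Rightarrow>
   (real \<Rightarrow> real \<Rightarrow> 'v \<Rightarrow> 'v) \<Rightarrow> (real \<Rightarrow> real \<Rightarrow> 'v \<Rightarrow> 'v) \<Rightarrow> bool" where
  "evolution_limit E J P T L \<longleftrightarrow> kSOT_limit E J P (evolution_prod T) L"

definition evolution_solvable ::
  "('k::real_normed_field, 'v::real_normed_vector) nspace \<Rightarrow> real set \<Rightarrow> real set set \<Rightarrow>
   (real \<Rightarrow> real \<Rightarrow> 'v \<Rightarrow> 'v) \<Rightarrow> bool" where
  "evolution_solvable E J P T \<longleftrightarrow> (\<exists>L. evolution_limit E J P T L)"

section \<open>The monitoring problem\<close>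

definition contraction_family ::
  "('k::real_normed_field, 'v::real_normed_vector) nspace \<Rightarrow> real set \<Rightarrow> (real \<Rightarrow> 'v \<Rightarrow> 'v) \<Rightarrow> bool" where
  "contraction_family V J X \<longleftrightarrow>
     (\<forall>\<tau>\<in>J. contraction V (X \<tau>)) \<and> (\<forall>x\<in>pts V. continuous_on J (\<lambda>\<tau>. X \<tau> x))"

text \<open>
  Only values of \<open>S\<close> at non-negative times enter here if \<open>t \<ge> s\<close>, so a group may be passed
  as \<open>S\<close> in place of its restriction to the non-negative reals.
\<close>

definition monitoring_prod ::
  "(real \<Rightarrow> 'v \<Rightarrow> 'v) \<Rightarrow> (real \<Rightarrow> 'v \<Rightarrow> 'v) \<Rightarrow> real set \<Rightarrow> real \<Rightarrow> real \<Rightarrow> 'v \<Rightarrow> 'v" where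
  "monitoring_prod X S \<Xi> t s = rev_prod (\<lambda>k. X (tau \<Xi> t s k) \<circ> S (dtau \<Xi> t s k)) (N_part \<Xi>)"

definition monitoring_limit ::
  "('k::real_normed_field, 'v::real_normed_vector) nspace \<Rightarrow> real set \<Rightarrow> real set set \<Rightarrow>
   (real \<Rightarrow> 'v \<Rightarrow> 'v) \<Rightarrow> (real \<Rightarrow> 'v \<Rightarrow> 'v) \<Rightarrow> (real \<Rightarrow> real \<Rightarrow> 'v \<Rightarrow> 'v) \<Rightarrow> bool" where
  "monitoring_limit V J P X S L \<longleftrightarrow> kSOT_limit V J P (monitoring_prod X S) L"

definition monitoring_solvable ::
  "('k::real_normed_field, 'v::real_normed_vector) nspace \<Rightarrow> real set \<Rightarrow> real set set \<Rightarrow>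
   (real \<Rightarrow> 'v \<Rightarrow> 'v) \<Rightarrow> (real \<Rightarrow> 'v \<Rightarrow> 'v) \<Rightarrow> bool" where
  "monitoring_solvable V J P X S \<longleftrightarrow> (\<exists>L. monitoring_limit V J P X S L)"

definition family_of_measurements ::
  "('k::real_normed_field, 'v::real_normed_vector) nspace \<Rightarrow> real set \<Rightarrow> (real \<Rightarrow> 'v \<Rightarrow> 'v) \<Rightarrow> bool" where
  "family_of_measurements V J M \<longleftrightarrow>
     contraction_family V J M \<and> (\<forall>\<sigma>\<in>J. \<forall>\<tau>\<in>J. \<forall>x\<in>pts V. M \<sigma> (M \<tau> x) = M \<tau> x)"

definition passivity ::
  "('k::real_normed_field, 'v::real_normed_vector) nspace \<Rightarrow> real set \<Rightarrow>
   (real \<Rightarrow> 'v \<Rightarrow> 'v) \<Rightarrow> (real \<Rightarrow> 'v \<Rightarrow> 'v) \<Rightarrow> bool" where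
  "passivity V J M U \<longleftrightarrow>
     (\<forall>\<tau>\<in>J. \<forall>s\<ge>0. \<forall>t\<ge>0. \<forall>x\<in>pts V.
        M \<tau> (U s (M \<tau> (M \<tau> (U t (M \<tau> x))))) = M \<tau> (U (s + t) (M \<tau> x)))"

definition passively_monitored_process ::
  "('k::real_normed_field, 'v::real_normed_vector) nspace \<Rightarrow> real set \<Rightarrow> real set set \<Rightarrow>
   (real \<Rightarrow> 'v \<Rightarrow> 'v) \<Rightarrow> (real \<Rightarrow> 'v \<Rightarrow> 'v) \<Rightarrow> bool" where
  "passively_monitored_process V J P M U \<longleftrightarrow>
     banach_space V \<and> self_similar P \<and> isometric_C0_group V U \<and>
     family_of_measurements V J M \<and> passivity V J M U"

end

theory Submission
  imports Defs
begin

text \<open>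
  The dilation space consists of paths: bounded continuous functions \<open>f\<close> of an index \<open>\<tau>\<close> and a time
  \<open>x\<close>, with values in \<open>E\<close>, on which the group \<open>U\<close> acts by translating the time. A vector \<open>\<xi>\<close> is
  embedded by \<open>r\<close> as its orbit \<open>(\<tau>, x) \<mapsto> T\<^sub>\<tau>(x) \<xi>\<close>, held constant at \<open>\<xi>\<close> for negative times; \<open>j\<^sub>\<tau>\<close> reads
  off the value at \<open>(\<tau>, 0)\<close>; and the measurement at \<open>\<tau>\<close> is \<open>r j\<^sub>\<tau>\<close>. Because \<open>j\<^sub>\<tau> r = 1\<close> for every
  \<open>\<tau>\<close>, all measurements share their range, and because \<open>j\<^sub>\<tau> U(d) r = T\<^sub>\<tau>(d)\<close> they are passive.

  The space must be neither too large nor too small. Translation is strongly continuous only on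
  paths that are uniformly continuous in time, so the others are discarded
  (\<open>path_space\<close>). Orbits survive this because \<open>J\<close> is compact: then \<open>T\<^sub>\<tau>(d) \<xi> \<rightarrow> \<xi>\<close> as \<open>d \<rightarrow> 0\<close>
  uniformly in \<open>\<tau>\<close>, and contractivity carries this to all later times
  (\<open>orbit_in_path_space\<close>).

  In a monitoring product, the identity \<open>j\<^sub>\<tau> U(d) r = T\<^sub>\<tau>(d)\<close> turns every factor but the first
  into a factor of the evolution product. Only the first one sees the path \<open>f\<close> away from
  \<open>(s, 0)\<close>, namely at the first point \<open>(s + d, d)\<close> of the partition
  (\<open>monitoring_prod_eq\<close>). Self-similarity makes the first gap \<open>d\<close> shrink to zero, so the monitoring
  product of \<open>f\<close> is asymptotically \<open>r\<close> applied to the evolution product of \<open>f (s, 0)\<close>, uniformly in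
  \<open>(t, s)\<close> (\<open>monitoring_prod_deviation\<close>). On orbits the equality is exact, which transports
  convergence back. In the forward direction the vector \<open>f (s, 0)\<close> varies with \<open>s\<close> but stays in a
  compact set, on which contractions converge uniformly
  (\<open>kSOT_limit_uniform_on_compact_vectors\<close>). The two formulas for the limits then follow from
  uniqueness of limits.
\<close>

section \<open>Operators and partitions\<close>

lemma banach_space_facts:
  assumes "banach_space V"
  shows "0 \<in> pts V"
    and "x \<in> pts V \<Longrightarrow> y \<in> pts V \<Longrightarrow> x + y \<in> pts V"
    and "x \<in> pts V \<Longrightarrow> y \<in> pts V \<Longrightarrow> x - y \<in> pts V"
    and "x \<in> pts V \<Longrightarrow> smul V c x \<in> pts V"
    and "norm (smul V c x) = norm c * norm x"
    and "smul V (of_real a) x = a *\<^sub>R x"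
    and "smul V c (x + y) = smul V c x + smul V c y"
    and "complete (pts V)"
    and "vector_space (smul V)"
proof -
  interpret vector_space "smul V"
    using assms by (simp add: banach_space_def)
  have sub: "module.subspace (smul V) (pts V)"
    using assms by (simp add: banach_space_def)
  show "0 \<in> pts V" using sub by (rule subspace_0)
  show "x \<in> pts V \<Longrightarrow> y \<in> pts V \<Longrightarrow> x + y \<in> pts V" using sub by (rule subspace_add)
  show "x \<in> pts V \<Longrightarrow> y \<in> pts V \<Longrightarrow> x - y \<in> pts V" using sub by (rule subspace_diff)
  show "x \<in> pts V \<Longrightarrow> smul V c x \<in> pts V" using sub by (rule subspace_scale)
  show "smul V c (x + y) = smul V c x + smul V c y" by (rule scale_right_distrib)
qed (use assms in \<open>simp_all add: banach_space_def\<close>)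

lemma smul_bounded_linear:
  assumes "banach_space V"
  shows "bounded_linear (smul V c)"
proof -
  interpret vector_space "smul V"
    by (rule banach_space_facts(9)[OF assms])
  show ?thesis
  proof (rule bounded_linear_intro)
    fix a x
    have "smul V c (smul V (of_real a) x) = smul V (of_real a) (smul V c x)"
      by (rule scale_left_commute)
    then show "smul V c (a *\<^sub>R x) = a *\<^sub>R smul V c x"
      unfolding banach_space_facts(6)[OF assms] .
    show "norm (smul V c x) \<le> norm x * norm c"
      by (simp add: banach_space_facts(5)[OF assms])
  qed (rule scale_right_distrib)
qed

lemma bounded_ops_facts:
  assumes "A \<in> bounded_ops V W"
  shows "x \<in> pts V \<Longrightarrow> A x \<in> pts W"
    and "x \<in> pts V \<Longrightarrow> y \<in> pts V \<Longrightarrow> A (x + y) = A x + A y"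
    and "x \<in> pts V \<Longrightarrow> A (smul V c x) = smul W c (A x)"
    and "\<exists>B. \<forall>x\<in>pts V. norm (A x) \<le> B * norm x"
  using assms unfolding bounded_ops_def by auto

lemma bounded_ops_diff:
  assumes "banach_space V" "A \<in> bounded_ops V W" "x \<in> pts V" "y \<in> pts V"
  shows "A (x - y) = A x - A y"
proof -
  have "A ((x - y) + y) = A (x - y) + A y"
    using assms(4) banach_space_facts(3)[OF assms(1,3,4)] by (intro bounded_ops_facts(2)[OF assms(2)])
  then show ?thesis by (simp add: algebra_simps)
qed

lemma bounded_ops_comp:
  assumes "A \<in> bounded_ops V W" "B \<in> bounded_ops W X"
  shows "(\<lambda>x. B (A x)) \<in> bounded_ops V X"
proof -
  obtain a where a: "\<And>x. x \<in> pts V \<Longrightarrow> norm (A x) \<le> a * norm x"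
    using bounded_ops_facts(4)[OF assms(1)] by blast
  obtain b where b: "\<And>x. x \<in> pts W \<Longrightarrow> norm (B x) \<le> b * norm x"
    using bounded_ops_facts(4)[OF assms(2)] by blast
  have AW: "A x \<in> pts W" if "x \<in> pts V" for x
    using that by (rule bounded_ops_facts(1)[OF assms(1)])
  have "norm (B (A x)) \<le> \<bar>b\<bar> * \<bar>a\<bar> * norm x" if x: "x \<in> pts V" for x
  proof -
    have "norm (B (A x)) \<le> b * norm (A x)" using b AW[OF x] by blast
    also have "\<dots> \<le> \<bar>b\<bar> * norm (A x)" by (intro mult_right_mono) auto
    also have "\<dots> \<le> \<bar>b\<bar> * (\<bar>a\<bar> * norm x)"
      using a[OF x] by (intro mult_left_mono order_trans[OF a[OF x]] mult_right_mono) auto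
    finally show ?thesis by simp
  qed
  then have "\<exists>C. \<forall>x\<in>pts V. norm (B (A x)) \<le> C * norm x" by blast
  then show ?thesis
    using assms unfolding bounded_ops_def by auto
qed

lemma rev_prod_contraction:
  assumes "\<And>k. 1 \<le> k \<Longrightarrow> k \<le> n \<Longrightarrow> contraction V (A k)"
  shows "contraction V (rev_prod A n)"
  using assms
proof (induction n)
  case 0
  show ?case unfolding contraction_def bounded_ops_def by (auto intro: exI[of _ 1])
next
  case (Suc n)
  then have A: "contraction V (A (Suc n))" and R: "contraction V (rev_prod A n)" by simp_all
  have "rev_prod A n x \<in> pts V" if "x \<in> pts V" for x
    using R that unfolding contraction_def by (blast intro: bounded_ops_facts(1))
  then have "norm (A (Suc n) (rev_prod A n x)) \<le> norm x" if "x \<in> pts V" for x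
    using A R that unfolding contraction_def by (meson order_trans)
  then show ?case
    using A R bounded_ops_comp[of "rev_prod A n" V V "A (Suc n)" V]
    unfolding contraction_def by (simp add: comp_def)
qed

lemma rev_prod_Suc_shift: "rev_prod A (Suc n) = rev_prod (\<lambda>k. A (Suc k)) n \<circ> A 1"
proof (induction n)
  case (Suc n)
  have "rev_prod A (Suc (Suc n)) = A (Suc (Suc n)) \<circ> rev_prod A (Suc n)" by simp
  also have "\<dots> = rev_prod (\<lambda>k. A (Suc k)) (Suc n) \<circ> A 1"
    unfolding Suc.IH by (simp add: comp_assoc)
  finally show ?case .
qed simp

lemma rev_prod_cong:
  "(\<And>k. 1 \<le> k \<Longrightarrow> k \<le> n \<Longrightarrow> A k = B k) \<Longrightarrow> rev_prod A n = rev_prod B n"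
  by (induction n) simp_all

text \<open>Partitions always contain both endpoints, so there is at least one factor in each product and
  all points stay between \<open>s\<close> and \<open>t\<close>.\<close>

lemma partition01_facts:
  assumes "\<Xi> \<in> partitions01"
  shows "N_part \<Xi> \<ge> 1" "sorted_list_of_set \<Xi> ! 0 = 0"
    and "s \<le> t \<Longrightarrow> k \<le> N_part \<Xi> \<Longrightarrow> s \<le> tau \<Xi> t s k \<and> tau \<Xi> t s k \<le> t"
    and "s \<le> t \<Longrightarrow> k \<le> N_part \<Xi> \<Longrightarrow> 0 \<le> dtau \<Xi> t s k"
proof -
  have X: "finite \<Xi>" "\<Xi> \<noteq> {}" "\<Xi> \<subseteq> {0..1}" "Min \<Xi> = 0" "Max \<Xi> = 1"
    using assms unfolding partitions01_def by blast+
  let ?l = "sorted_list_of_set \<Xi>"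
  have len: "length ?l = card \<Xi>" by simp
  have sub: "{0,1} \<subseteq> \<Xi>" using Min_in[OF X(1,2)] Max_in[OF X(1,2)] X(4,5) by simp
  have "card {0,1::real} \<le> card \<Xi>" using X(1) sub by (rule card_mono)
  then have c: "card \<Xi> \<ge> 2" by simp
  then show "N_part \<Xi> \<ge> 1" by (simp add: N_part_def)
  show "?l ! 0 = 0" using sorted_list_of_set_nonempty[OF X(1,2)] X(4) by simp
  {
    assume st: "s \<le> t" and k: "k \<le> N_part \<Xi>"
    have kl: "k < length ?l" using k c by (simp add: N_part_def)
    then have "?l ! k \<in> \<Xi>" using nth_mem[of k ?l] X(1) by simp
    then have u: "0 \<le> ?l ! k" "?l ! k \<le> 1" using X(3) by auto
    have "(t - s) * (?l ! k) \<le> (t - s) * 1" using st u by (intro mult_left_mono) auto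
    then show "s \<le> tau \<Xi> t s k \<and> tau \<Xi> t s k \<le> t"
      using st u by (simp add: tau_def)
    have "?l ! (k - 1) \<le> ?l ! k" using kl by (intro sorted_nth_mono) auto
    then have "(t - s) * (?l ! (k - 1)) \<le> (t - s) * (?l ! k)" using st by (intro mult_left_mono) auto
    then show "0 \<le> dtau \<Xi> t s k" by (simp add: dtau_def tau_def)
  }
qed

text \<open>Splitting a partition of a self-similar system at \<open>\<alpha> > 0\<close> gives one that contains \<open>\<alpha>\<close>; every
  refinement contains it too, so that its first point after \<open>0\<close> lies in \<open>[0, \<alpha>]\<close>.\<close>

lemma eventually_first_point_small:
  assumes P: "self_similar P" and e: "0 < e"
  shows "\<forall>\<^sub>F \<Xi> in refinement P. \<Xi> \<in> P \<and> sorted_list_of_set \<Xi> ! 1 \<le> e"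
proof -
  define \<alpha> where "\<alpha> = min e 1"
  have \<alpha>: "\<alpha> \<in> {0..1}" "\<alpha> > 0" "\<alpha> \<le> e" using e by (auto simp: \<alpha>_def)
  have PP: "P \<subseteq> partitions01" using P by (simp add: self_similar_def)
  obtain \<Xi> where "\<Xi> \<in> P" using P unfolding self_similar_def by blast
  then have "\<forall>\<alpha>\<in>{0..1}. \<exists>A\<in>P. \<exists>B\<in>P. \<exists>C\<in>P.
      C = (\<lambda>x. \<alpha> * x) ` A \<union> (\<lambda>x. \<alpha> + (1 - \<alpha>) * x) ` B \<and> C \<supseteq> \<Xi>"
    using P unfolding self_similar_def by (elim conjE) (erule (1) bspec)
  then have "\<exists>A\<in>P. \<exists>B\<in>P. \<exists>C\<in>P.
      C = (\<lambda>x. \<alpha> * x) ` A \<union> (\<lambda>x. \<alpha> + (1 - \<alpha>) * x) ` B \<and> C \<supseteq> \<Xi>"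
    using \<alpha>(1) by (rule bspec)
  then obtain A B C where C: "A \<in> P" "C \<in> P" "C = (\<lambda>x. \<alpha> * x) ` A \<union> (\<lambda>x. \<alpha> + (1 - \<alpha>) * x) ` B"
    by (elim bexE conjE) (rule that)
  have A: "finite A" "A \<noteq> {}" "Max A = 1"
    using C(1) PP unfolding partitions01_def by blast+
  have "1 \<in> A" using Max_in[OF A(1,2)] A(3) by simp
  then have \<alpha>C: "\<alpha> \<in> C" unfolding C(3) by force
  have "sorted_list_of_set D ! 1 \<le> e" if D: "D \<in> P" "C \<subseteq> D" for D
  proof -
    let ?l = "sorted_list_of_set D"
    have part: "D \<in> partitions01" using D PP by blast
    then have "\<alpha> \<in> set ?l" using D \<alpha>C by (auto simp: partitions01_def)
    then obtain i where i: "i < length ?l" "?l ! i = \<alpha>" by (metis in_set_conv_nth)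
    have "i \<noteq> 0" using partition01_facts(2)[OF part] i \<alpha> by (intro notI) simp
    then have "?l ! 1 \<le> ?l ! i" using i by (intro sorted_nth_mono) auto
    then show ?thesis using i \<alpha> by simp
  qed
  then show ?thesis unfolding eventually_refinement[OF P] using C(2) by blast
qed

lemma refinement_neq_bot: "self_similar P \<Longrightarrow> refinement P \<noteq> bot"
  unfolding trivial_limit_def by (auto simp: eventually_refinement)

lemma eventually_refinement_mem: "self_similar P \<Longrightarrow> \<forall>\<^sub>F \<Xi> in refinement P. \<Xi> \<in> P"
  unfolding eventually_refinement by (auto simp: self_similar_def)

lemma kSOT_limit_tendsto:
  assumes "kSOT_limit V J P F L" "(t, s) \<in> Delta J" "\<xi> \<in> pts V"
  shows "((\<lambda>\<Xi>. F \<Xi> t s \<xi>) \<longlongrightarrow> L t s \<xi>) (refinement P)"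
proof -
  have "uniform_limit {(t, s)} (\<lambda>\<Xi> (t, s). F \<Xi> t s \<xi>) (\<lambda>(t, s). L t s \<xi>) (refinement P)"
    using assms unfolding kSOT_limit_def by (metis compact_sing empty_subsetI insert_subset)
  then show ?thesis by (auto dest!: tendsto_uniform_limitI)
qed

lemma kSOT_limit_unique:
  assumes "self_similar P" "kSOT_limit V J P F L" "kSOT_limit V J P F L'"
    and "(t, s) \<in> Delta J" "\<xi> \<in> pts V"
  shows "L t s \<xi> = L' t s \<xi>"
  using kSOT_limit_tendsto[OF assms(2,4,5)] kSOT_limit_tendsto[OF assms(3,4,5)]
    tendsto_unique[OF refinement_neq_bot[OF assms(1)]] by blast

text \<open>Contractions, and hence their limits, move nearby vectors to nearby vectors, so convergence on a
  finite net of the compact set is enough.\<close>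

lemma kSOT_limit_uniform_on_compact_vectors:
  assumes V: "banach_space V" and P: "self_similar P" and lim: "kSOT_limit V J P F L"
    and con: "\<And>\<Xi> t s. \<Xi> \<in> P \<Longrightarrow> (t, s) \<in> Delta J \<Longrightarrow> contraction V (F \<Xi> t s)"
    and C: "compact C" "C \<subseteq> Delta J" and X: "compact X" "X \<subseteq> pts V" and e: "0 < e"
  shows "\<forall>\<^sub>F \<Xi> in refinement P. \<forall>(t, s)\<in>C. \<forall>\<xi>\<in>X. norm (F \<Xi> t s \<xi> - L t s \<xi>) < e"
proof -
  have Lops: "L t s \<in> bounded_ops V V" if "(t, s) \<in> Delta J" for t s
    using lim that unfolding kSOT_limit_def by blast
  have Lcon: "norm (L t s \<xi>) \<le> norm \<xi>" if ts: "(t, s) \<in> Delta J" and \<xi>: "\<xi> \<in> pts V" for t s \<xi>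
  proof (rule tendsto_upperbound[OF tendsto_norm[OF kSOT_limit_tendsto[OF lim ts \<xi>]]])
    show "\<forall>\<^sub>F \<Xi> in refinement P. norm (F \<Xi> t s \<xi>) \<le> norm \<xi>"
      using eventually_refinement_mem[OF P]
      by eventually_elim (use con ts \<xi> in \<open>auto simp: contraction_def\<close>)
  qed (rule refinement_neq_bot[OF P])
  have e3: "0 < e / 3" using e by simp
  obtain k where k: "finite k" "k \<subseteq> X" "X \<subseteq> (\<Union>x\<in>k. ball x (e / 3))"
    using seq_compact_imp_totally_bounded[OF compact_imp_seq_compact[OF X(1)]] e3 by meson
  have "\<forall>\<^sub>F \<Xi> in refinement P. \<forall>p\<in>C.
      dist (case p of (t, s) \<Rightarrow> F \<Xi> t s \<eta>) (case p of (t, s) \<Rightarrow> L t s \<eta>) < e / 3" if "\<eta> \<in> k" for \<eta>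
    by (rule uniform_limitD[OF _ e3]) (use lim C X k that in \<open>unfold kSOT_limit_def, blast\<close>)
  then have "\<forall>\<^sub>F \<Xi> in refinement P. \<forall>\<eta>\<in>k. \<forall>p\<in>C.
      dist (case p of (t, s) \<Rightarrow> F \<Xi> t s \<eta>) (case p of (t, s) \<Rightarrow> L t s \<eta>) < e / 3"
    using k(1) by (simp add: eventually_ball_finite)
  then show ?thesis
    using eventually_refinement_mem[OF P]
  proof eventually_elim
    case (elim \<Xi>)
    have "norm (F \<Xi> t s \<xi> - L t s \<xi>) < e" if ts: "(t, s) \<in> C" and \<xi>: "\<xi> \<in> X" for t s \<xi>
    proof -
      obtain \<eta> where \<eta>: "\<eta> \<in> k" "dist \<eta> \<xi> < e / 3" using k(3) \<xi> by auto
      have tsD: "(t, s) \<in> Delta J" using ts C by blast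
      have pts: "\<xi> \<in> pts V" "\<eta> \<in> pts V" using \<xi> \<eta> k(2) X(2) by blast+
      note Fc = con[OF elim(2) tsD, unfolded contraction_def]
      have d: "\<xi> - \<eta> \<in> pts V" using banach_space_facts(3)[OF V pts] .
      have "norm (F \<Xi> t s \<xi> - F \<Xi> t s \<eta>) \<le> norm (\<xi> - \<eta>)"
        using Fc d bounded_ops_diff[OF V _ pts, of "F \<Xi> t s" V] by metis
      moreover have "norm (L t s \<xi> - L t s \<eta>) \<le> norm (\<xi> - \<eta>)"
        using Lcon[OF tsD d] bounded_ops_diff[OF V Lops[OF tsD] pts] by metis
      moreover have "norm (\<xi> - \<eta>) < e / 3" using \<eta>(2) by (simp add: dist_norm norm_minus_commute)
      moreover have "norm (F \<Xi> t s \<eta> - L t s \<eta>) < e / 3"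
        using elim(1) \<eta>(1) ts by (force simp: dist_norm)
      moreover have "norm (F \<Xi> t s \<xi> - L t s \<xi>) \<le>
          norm (F \<Xi> t s \<xi> - F \<Xi> t s \<eta>) + norm (F \<Xi> t s \<eta> - L t s \<eta>) + norm (L t s \<xi> - L t s \<eta>)"
        by norm
      ultimately show ?thesis by linarith
    qed
    then show ?case by blast
  qed
qed

section \<open>Spaces of paths\<close>

definition translate :: "real \<Rightarrow> ((real \<times> real) \<Rightarrow>\<^sub>C 'v::real_normed_vector) \<Rightarrow> ((real \<times> real) \<Rightarrow>\<^sub>C 'v)" where
  "translate h f = Bcontfun (\<lambda>p. apply_bcontfun f (fst p, snd p + h))"

text \<open>Translations act strongly continuously only on functions that are uniformly continuous in the
  translated variable, uniformly in the index; these are exactly the functions kept here.\<close>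

definition path_space ::
  "('k::real_normed_field, 'v::real_normed_vector) nspace \<Rightarrow> ('k, (real \<times> real) \<Rightarrow>\<^sub>C 'v) nspace" where
  "path_space E =
     \<lparr>pts = {f. (\<forall>p. apply_bcontfun f p \<in> pts E) \<and> continuous_on UNIV (\<lambda>h. translate h f)},
      smul = (\<lambda>c f. Bcontfun (\<lambda>p. smul E c (f p)))\<rparr>"

lemma apply_translate [simp]: "apply_bcontfun (translate h f) p = apply_bcontfun f (fst p, snd p + h)"
proof -
  have "continuous_on UNIV (\<lambda>p. apply_bcontfun f (fst p, snd p + h))"
    by (rule continuous_on_compose2[OF continuous_on_apply_bcontfun[of UNIV f]])
      (auto intro!: continuous_intros)
  then have "(\<lambda>p. apply_bcontfun f (fst p, snd p + h)) \<in> bcontfun"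
    by (rule bcontfun_normI[of _ "norm f"]) (rule norm_bounded)
  then show ?thesis by (simp add: translate_def Bcontfun_inverse)
qed

lemma translate_add: "translate h (f + g) = translate h f + translate h g"
  and translate_diff: "translate h (f - g) = translate h f - translate h g"
  and translate_translate: "translate h (translate k f) = translate (h + k) f"
  and translate_0: "translate 0 f = f"
  by (rule bcontfun_eqI; simp add: algebra_simps)+

lemma norm_translate: "norm (translate h f) = norm f"
proof (rule antisym)
  show le: "norm (translate h f) \<le> norm f" for h and f :: "(real \<times> real) \<Rightarrow>\<^sub>C 'a"
    by (rule norm_bound) (simp add: norm_bounded)
  show "norm f \<le> norm (translate h f)"
    using le[of "- h" "translate h f"] by (simp add: translate_translate translate_0)
qed

lemma dist_translate: "dist (translate h f) (translate h g) = dist f g"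
  by (simp add: dist_norm norm_translate flip: translate_diff)

context
  fixes E :: "('k::real_normed_field, 'v::real_normed_vector) nspace"
  assumes E: "banach_space E"
begin

lemma path_space_smul [simp]:
  "apply_bcontfun (smul (path_space E) c f) p = smul E c (f p)"
proof -
  interpret bounded_linear "smul E c" by (rule smul_bounded_linear[OF E])
  have "continuous_on UNIV (\<lambda>p. smul E c (f p))"
    by (intro continuous_on continuous_on_apply_bcontfun)
  moreover have "norm (smul E c (f p)) \<le> norm c * norm f" for p
    by (simp add: banach_space_facts(5)[OF E] mult_left_mono norm_bounded)
  ultimately have "(\<lambda>p. smul E c (f p)) \<in> bcontfun"
    by (rule bcontfun_normI)
  then show ?thesis by (simp add: path_space_def Bcontfun_inverse)
qed

lemma path_space_pts:
  "f \<in> pts (path_space E) \<longleftrightarrow>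
     (\<forall>p. apply_bcontfun f p \<in> pts E) \<and> continuous_on UNIV (\<lambda>h. translate h f)"
  by (simp add: path_space_def)

lemma norm_path_space_smul: "norm (smul (path_space E) c f) = norm c * norm f"
proof (rule antisym)
  show le: "norm (smul (path_space E) c f) \<le> norm c * norm f" for c f
    by (rule norm_bound) (simp add: banach_space_facts(5)[OF E] mult_left_mono norm_bounded)
  interpret vector_space "smul E" by (rule banach_space_facts(9)[OF E])
  show "norm c * norm f \<le> norm (smul (path_space E) c f)"
  proof (cases "c = 0")
    case False
    have "smul (path_space E) (inverse c) (smul (path_space E) c f) = f"
      using False by (intro bcontfun_eqI) simp
    then have "norm f \<le> inverse (norm c) * norm (smul (path_space E) c f)"
      using le[of "inverse c" "smul (path_space E) c f"] by (simp add: norm_inverse)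
    then show ?thesis using False by (simp add: field_simps)
  qed simp
qed

lemma translate_smul:
  "translate h (smul (path_space E) c f) = smul (path_space E) c (translate h f)"
  by (rule bcontfun_eqI) simp

lemma path_space_vector_space: "vector_space (smul (path_space E))"
proof -
  interpret vector_space "smul E" by (rule banach_space_facts(9)[OF E])
  show ?thesis
    by unfold_locales (auto intro!: bcontfun_eqI simp: scale_right_distrib scale_left_distrib)
qed

lemma path_space_smul_bounded_linear: "bounded_linear (smul (path_space E) c)"
proof (rule bounded_linear_intro)
  fix f g :: "(real \<times> real) \<Rightarrow>\<^sub>C 'v" and a
  interpret bounded_linear "smul E c" by (rule smul_bounded_linear[OF E])
  show "smul (path_space E) c (f + g) = smul (path_space E) c f + smul (path_space E) c g"
    by (rule bcontfun_eqI) (simp add: add)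
  show "smul (path_space E) c (a *\<^sub>R f) = a *\<^sub>R smul (path_space E) c f"
    by (rule bcontfun_eqI) (simp add: scaleR)
  show "norm (smul (path_space E) c f) \<le> norm f * norm c"
    by (simp add: norm_path_space_smul)
qed

text \<open>The values of a Cauchy sequence converge in the complete set \<open>pts E\<close>, uniformly in the argument.
  Translations are isometries, so uniform limits inherit continuity of the orbit
  \<open>h \<mapsto> translate h f\<close>.\<close>

lemma path_space_complete: "complete (pts (path_space E))"
proof (rule completeI)
  fix f :: "nat \<Rightarrow> ((real \<times> real) \<Rightarrow>\<^sub>C 'v)"
  assume f: "\<forall>n. f n \<in> pts (path_space E)" and Cf: "Cauchy f"
  have fE: "f n p \<in> pts E" for n p using f unfolding path_space_pts by blast
  have "Cauchy (\<lambda>n. f n p)" for p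
    using Cf unfolding Cauchy_def by (meson dist_bounded le_less_trans)
  then have "\<forall>p. \<exists>l. l \<in> pts E \<and> (\<lambda>n. f n p) \<longlonglongrightarrow> l"
    using banach_space_facts(8)[OF E] fE unfolding complete_def by meson
  then obtain g where g: "\<And>p. g p \<in> pts E" "\<And>p. (\<lambda>n. f n p) \<longlonglongrightarrow> g p" by metis
  have "uniform_limit UNIV f g sequentially"
    unfolding uniform_limit_sequentially_iff
  proof (intro allI impI)
    fix e :: real assume "0 < e"
    then obtain N where N: "\<And>m n. m \<ge> N \<Longrightarrow> n \<ge> N \<Longrightarrow> dist (f m) (f n) < e / 2"
      using Cf unfolding Cauchy_def by (meson half_gt_zero)
    have "dist (f n p) (g p) < e" if n: "n \<ge> N" for n p
    proof -
      have "(\<lambda>m. dist (f n p) (f m p)) \<longlonglongrightarrow> dist (f n p) (g p)"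
        by (intro tendsto_intros g(2))
      moreover have "\<forall>\<^sub>F m in sequentially. dist (f n p) (f m p) \<le> e / 2"
        using eventually_ge_at_top[of N]
        by eventually_elim (meson N n dist_bounded less_imp_le order_trans)
      ultimately have "dist (f n p) (g p) \<le> e / 2"
        by (rule tendsto_upperbound) simp
      then show ?thesis using \<open>0 < e\<close> by simp
    qed
    then show "\<exists>N. \<forall>n\<ge>N. \<forall>x\<in>UNIV. dist (f n x) (g x) < e" by blast
  qed
  then obtain l where l: "g = apply_bcontfun l" "f \<longlonglongrightarrow> l"
    by (rule uniform_limit_bcontfunE) simp
  have "uniform_limit UNIV (\<lambda>n h. translate h (f n)) (\<lambda>h. translate h l) sequentially"
    using l(2) by (auto simp: uniform_limit_iff dist_translate tendsto_iff)
  then have "continuous_on UNIV (\<lambda>h. translate h l)"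
    by (rule uniform_limit_theorem[rotated]) (use f in \<open>auto simp: path_space_pts\<close>)
  then show "\<exists>l\<in>pts (path_space E). f \<longlonglongrightarrow> l"
    using g l by (auto simp: path_space_pts)
qed

lemma path_space_banach: "banach_space (path_space E)"
proof -
  interpret vector_space "smul (path_space E)" by (rule path_space_vector_space)
  have "subspace (pts (path_space E))"
  proof (rule subspaceI)
    show "0 \<in> pts (path_space E)"
    proof -
      have "translate h 0 = (0 :: (real \<times> real) \<Rightarrow>\<^sub>C 'v)" for h by (rule bcontfun_eqI) simp
      then show ?thesis by (simp add: path_space_pts banach_space_facts(1)[OF E])
    qed
    fix f g c assume f: "f \<in> pts (path_space E)"
    show "smul (path_space E) c f \<in> pts (path_space E)"
      using f bounded_linear.continuous_on[OF path_space_smul_bounded_linear]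
      by (auto simp: path_space_pts translate_smul banach_space_facts(4)[OF E])
    assume "g \<in> pts (path_space E)"
    with f show "f + g \<in> pts (path_space E)"
      by (auto simp: path_space_pts translate_add banach_space_facts(2)[OF E] intro!: continuous_intros)
  qed
  moreover have "smul (path_space E) (of_real a) f = a *\<^sub>R f" for a f
    by (rule bcontfun_eqI) (simp add: banach_space_facts(6)[OF E])
  ultimately show ?thesis
    using vector_space_axioms path_space_complete
    by (simp add: banach_space_def norm_path_space_smul)
qed

lemma translate_isometric_C0_group: "isometric_C0_group (path_space E) translate"
proof -
  have pts: "translate h f \<in> pts (path_space E)" if "f \<in> pts (path_space E)" for h f
  proof -
    have "continuous_on UNIV (\<lambda>k. translate (k + h) f)"
      by (rule continuous_on_compose2[of UNIV "\<lambda>k. translate k f"])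
        (use that in \<open>auto simp: path_space_pts intro!: continuous_intros\<close>)
    then show ?thesis using that by (simp add: path_space_pts translate_translate)
  qed
  have "\<forall>f\<in>pts (path_space E). norm (translate h f) \<le> 1 * norm f" for h
    by (simp add: norm_translate)
  then have "translate h \<in> bounded_ops (path_space E) (path_space E)" for h
    unfolding bounded_ops_def using pts by (fastforce simp: translate_add translate_smul intro: exI[of _ 1])
  moreover have "translate h ` pts (path_space E) = pts (path_space E)" for h
  proof (intro subset_antisym subsetI)
    fix f assume "f \<in> pts (path_space E)"
    then have "translate (- h) f \<in> pts (path_space E)" by (rule pts)
    moreover have "f = translate h (translate (- h) f)" by (simp add: translate_translate translate_0)
    ultimately show "f \<in> translate h ` pts (path_space E)" by (rule rev_image_eqI)
  qed (use pts in auto)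
  ultimately show ?thesis
    by (auto simp: isometric_C0_group_def norm_translate translate_translate translate_0 path_space_pts)
qed

end

lemma continuous_on_apply_bcontfun_joint:
  fixes F :: "'a::topological_space \<Rightarrow> ('b::topological_space \<Rightarrow>\<^sub>C 'c::real_normed_vector)"
  assumes F: "continuous_on S F" and p: "continuous_on S p"
  shows "continuous_on S (\<lambda>z. apply_bcontfun (F z) (p z))"
  \<comment> \<open>Evaluation is 1-Lipschitz in the function, so only the point moves in the limit.\<close>
  unfolding continuous_on_def
proof
  fix z assume z: "z \<in> S"
  have "((\<lambda>y. F y - F z) \<longlongrightarrow> 0) (at z within S)"
    using F z by (simp add: continuous_on_def LIM_zero_iff)
  then have "((\<lambda>y. apply_bcontfun (F y) (p y) - apply_bcontfun (F z) (p y)) \<longlongrightarrow> 0) (at z within S)"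
  proof (rule Lim_null_comparison[rotated, OF tendsto_norm_zero])
    show "\<forall>\<^sub>F y in at z within S. norm (F y (p y) - F z (p y)) \<le> norm (F y - F z)"
      using norm_bounded[of "F y - F z" "p y" for y] by (intro always_eventually) simp
  qed
  moreover have "continuous_on S (\<lambda>y. apply_bcontfun (F z) (p y))"
    by (rule continuous_on_compose2[OF continuous_on_apply_bcontfun[of UNIV] p]) simp
  then have "((\<lambda>y. apply_bcontfun (F z) (p y)) \<longlongrightarrow> F z (p z)) (at z within S)"
    using z by (simp add: continuous_on_def)
  ultimately show "((\<lambda>y. apply_bcontfun (F y) (p y)) \<longlongrightarrow> F z (p z)) (at z within S)"
    by (rule Lim_transform[rotated])
qed

lemma evaluation_bounded_ops:
  assumes E: "banach_space E"
  shows "(\<lambda>f. apply_bcontfun f p) \<in> bounded_ops (path_space E) E"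
proof -
  have "\<exists>B. \<forall>f\<in>pts (path_space E). norm (apply_bcontfun f p) \<le> B * norm f"
    using norm_bounded by (intro exI[of _ 1]) auto
  then show ?thesis
    unfolding bounded_ops_def by (auto simp: path_space_pts[OF E] path_space_smul[OF E] simp del: split_paired_All)
qed

section \<open>The dilation\<close>

text \<open>The index runs over the whole line, where bounded continuous functions live; the last assumption
  stands in for compactness of the index set.\<close>

locale semigroup_family =
  fixes E :: "('k::real_normed_field, 'v::real_normed_vector) nspace"
    and Z :: "real \<Rightarrow> real \<Rightarrow> 'v \<Rightarrow> 'v"
  assumes banach: "banach_space E"
    and semigroup: "contractive_C0_semigroup E (Z \<tau>)"
    and jointly_continuous:
      "\<xi> \<in> pts E \<Longrightarrow> continuous_on (UNIV \<times> {0..}) (\<lambda>p. Z (fst p) (snd p) \<xi>)"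
    and equicontinuous:
      "\<xi> \<in> pts E \<Longrightarrow> 0 < e \<Longrightarrow> \<exists>\<delta>>0. \<forall>\<tau> d. 0 \<le> d \<and> d < \<delta> \<longrightarrow> norm (Z \<tau> d \<xi> - \<xi>) < e"
begin

lemma Z_facts:
  shows "0 \<le> x \<Longrightarrow> contraction E (Z \<tau> x)"
    and "0 \<le> x \<Longrightarrow> Z \<tau> x \<in> bounded_ops E E"
    and "0 \<le> x \<Longrightarrow> \<xi> \<in> pts E \<Longrightarrow> Z \<tau> x \<xi> \<in> pts E"
    and "0 \<le> x \<Longrightarrow> \<xi> \<in> pts E \<Longrightarrow> norm (Z \<tau> x \<xi>) \<le> norm \<xi>"
    and "\<xi> \<in> pts E \<Longrightarrow> Z \<tau> 0 \<xi> = \<xi>"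
    and "0 \<le> x \<Longrightarrow> 0 \<le> y \<Longrightarrow> \<xi> \<in> pts E \<Longrightarrow> Z \<tau> (x + y) \<xi> = Z \<tau> x (Z \<tau> y \<xi>)"
proof -
  note S = semigroup[of \<tau>, unfolded contractive_C0_semigroup_def]
  show c: "contraction E (Z \<tau> x)" if "0 \<le> x" using S that by blast
  then show b: "Z \<tau> x \<in> bounded_ops E E" if "0 \<le> x" using that unfolding contraction_def by blast
  show "Z \<tau> x \<xi> \<in> pts E" if "0 \<le> x" "\<xi> \<in> pts E"
    using bounded_ops_facts(1)[OF b] that by blast
  show "norm (Z \<tau> x \<xi>) \<le> norm \<xi>" if "0 \<le> x" "\<xi> \<in> pts E"
    using c that unfolding contraction_def by blast
  show "Z \<tau> 0 \<xi> = \<xi>" if "\<xi> \<in> pts E" using S that by blast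
  show "Z \<tau> (x + y) \<xi> = Z \<tau> x (Z \<tau> y \<xi>)" if "0 \<le> x" "0 \<le> y" "\<xi> \<in> pts E"
    using S that by blast
qed

definition orbit :: "'v \<Rightarrow> (real \<times> real) \<Rightarrow>\<^sub>C 'v" where
  "orbit \<xi> = Bcontfun (\<lambda>p. Z (fst p) (max 0 (snd p)) \<xi>)"

definition meas :: "real \<Rightarrow> ((real \<times> real) \<Rightarrow>\<^sub>C 'v) \<Rightarrow> (real \<times> real) \<Rightarrow>\<^sub>C 'v" where
  "meas \<tau> f = orbit (apply_bcontfun f (\<tau>, 0))"

lemma orbit_apply:
  assumes "\<xi> \<in> pts E"
  shows "apply_bcontfun (orbit \<xi>) p = Z (fst p) (max 0 (snd p)) \<xi>"
proof -
  have "continuous_on UNIV (\<lambda>p :: real \<times> real. Z (fst (fst p, max 0 (snd p))) (snd (fst p, max 0 (snd p))) \<xi>)"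
    by (rule continuous_on_compose2[OF jointly_continuous[OF assms]]) (auto intro!: continuous_intros)
  then have "continuous_on UNIV (\<lambda>p :: real \<times> real. Z (fst p) (max 0 (snd p)) \<xi>)" by simp
  moreover have "norm (Z (fst p) (max 0 (snd p)) \<xi>) \<le> norm \<xi>" for p :: "real \<times> real"
    by (rule Z_facts) (use assms in auto)
  ultimately have "(\<lambda>p. Z (fst p) (max 0 (snd p)) \<xi>) \<in> bcontfun" by (rule bcontfun_normI)
  then show ?thesis by (simp add: orbit_def Bcontfun_inverse)
qed

lemma orbit_apply_0 [simp]: "\<xi> \<in> pts E \<Longrightarrow> apply_bcontfun (orbit \<xi>) (\<tau>, 0) = \<xi>"
  by (simp add: orbit_apply Z_facts)

lemma norm_orbit:
  assumes "\<xi> \<in> pts E"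
  shows "norm (orbit \<xi>) = norm \<xi>"
proof (rule antisym)
  show "norm (orbit \<xi>) \<le> norm \<xi>"
    by (rule norm_bound) (simp add: orbit_apply assms Z_facts)
  show "norm \<xi> \<le> norm (orbit \<xi>)"
    using norm_bounded[of "orbit \<xi>" "(0, 0)"] assms by simp
qed

text \<open>By the semigroup law and contractivity, the increment of an orbit over a time step of length
  \<open>d\<close> is, for each index, nowhere larger than its increment over \<open>[0, d]\<close>. Hence orbits
  are uniformly continuous in time, uniformly in the index.\<close>

lemma orbit_in_path_space:
  assumes \<xi>: "\<xi> \<in> pts E"
  shows "orbit \<xi> \<in> pts (path_space E)"
proof -
  have "continuous_on UNIV (\<lambda>h. translate h (orbit \<xi>))"
    unfolding continuous_on_iff
  proof (intro ballI allI impI)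
    fix h e :: real assume "0 < e"
    then obtain \<delta> where \<delta>: "\<delta> > 0"
      "\<And>\<tau> d. 0 \<le> d \<Longrightarrow> d < \<delta> \<Longrightarrow> norm (Z \<tau> d \<xi> - \<xi>) < e / 2"
      using equicontinuous[OF \<xi>, of "e / 2"] by auto
    have step: "norm (Z \<tau> y \<xi> - Z \<tau> x \<xi>) < e / 2" if "0 \<le> x" "x \<le> y" "y - x < \<delta>" for \<tau> x y
    proof -
      have "Z \<tau> y \<xi> - Z \<tau> x \<xi> = Z \<tau> x (Z \<tau> (y - x) \<xi>) - Z \<tau> x \<xi>"
        using Z_facts(6)[of x "y - x" \<xi> \<tau>] that \<xi> by simp
      also have "\<dots> = Z \<tau> x (Z \<tau> (y - x) \<xi> - \<xi>)"
        using bounded_ops_diff[OF banach Z_facts(2)] that \<xi> by (simp add: Z_facts)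
      finally have "norm (Z \<tau> y \<xi> - Z \<tau> x \<xi>) = norm (Z \<tau> x (Z \<tau> (y - x) \<xi> - \<xi>))"
        by (rule arg_cong)
      also have "\<dots> \<le> norm (Z \<tau> (y - x) \<xi> - \<xi>)"
        using that \<xi> by (intro Z_facts banach_space_facts(3)[OF banach]) auto
      also have "\<dots> < e / 2" using that by (intro \<delta>) auto
      finally show ?thesis .
    qed
    have "dist (translate k (orbit \<xi>)) (translate h (orbit \<xi>)) < e" if k: "dist k h < \<delta>" for k
    proof -
      have "dist (translate k (orbit \<xi>) p) (translate h (orbit \<xi>) p) \<le> e / 2" for p
      proof -
        let ?x = "max 0 (snd p + h)" and ?y = "max 0 (snd p + k)"
        have xy: "\<bar>?y - ?x\<bar> < \<delta>" using k by (auto simp: dist_real_def)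
        have "norm (Z (fst p) ?y \<xi> - Z (fst p) ?x \<xi>) < e / 2"
        proof (cases "?x \<le> ?y")
          case True
          then show ?thesis using xy by (intro step) auto
        next
          case False
          then have "norm (Z (fst p) ?x \<xi> - Z (fst p) ?y \<xi>) < e / 2" using xy by (intro step) auto
          then show ?thesis by (simp add: norm_minus_commute)
        qed
        then show ?thesis by (simp add: orbit_apply \<xi> dist_norm)
      qed
      then have "dist (translate k (orbit \<xi>)) (translate h (orbit \<xi>)) \<le> e / 2" by (rule dist_bound)
      then show ?thesis using \<open>0 < e\<close> by simp
    qed
    then show "\<exists>\<delta>>0. \<forall>k\<in>UNIV. dist k h < \<delta> \<longrightarrow>
        dist (translate k (orbit \<xi>)) (translate h (orbit \<xi>)) < e"
      using \<delta>(1) by blast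
  qed
  then show ?thesis
    using \<xi> by (auto simp: path_space_pts[OF banach] orbit_apply Z_facts)
qed

lemma orbit_isometric: "isometric_embedding E (path_space E) orbit"
proof -
  note lin = bounded_ops_facts[OF Z_facts(2)]
  have "orbit (\<xi> + \<eta>) = orbit \<xi> + orbit \<eta>" if "\<xi> \<in> pts E" "\<eta> \<in> pts E" for \<xi> \<eta>
    using that by (intro bcontfun_eqI) (simp add: orbit_apply lin(2) banach_space_facts(2)[OF banach])
  moreover have "orbit (smul E c \<xi>) = smul (path_space E) c (orbit \<xi>)" if "\<xi> \<in> pts E" for c \<xi>
    using that
    by (intro bcontfun_eqI)
      (simp add: orbit_apply lin(3) banach_space_facts(4)[OF banach] path_space_smul[OF banach])
  moreover have "\<exists>B. \<forall>\<xi>\<in>pts E. norm (orbit \<xi>) \<le> B * norm \<xi>"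
    by (intro exI[of _ 1]) (simp add: norm_orbit)
  ultimately show ?thesis
    unfolding isometric_embedding_def bounded_ops_def by (simp add: norm_orbit orbit_in_path_space)
qed

lemma orbit_bounded_ops: "orbit \<in> bounded_ops E (path_space E)"
  using orbit_isometric by (simp add: isometric_embedding_def)

lemma norm_orbit_diff:
  assumes "\<xi> \<in> pts E" "\<eta> \<in> pts E"
  shows "norm (orbit \<xi> - orbit \<eta>) = norm (\<xi> - \<eta>)"
  using bounded_ops_diff[OF banach orbit_bounded_ops assms]
    norm_orbit[OF banach_space_facts(3)[OF banach assms]] by simp

lemma evaluation_surjective_isometry:
  "surjective_isometry (path_space E) E (\<lambda>f. apply_bcontfun f (\<tau>, 0))"
proof -
  have "(\<lambda>f. apply_bcontfun f (\<tau>, 0)) ` pts (path_space E) = pts E"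
  proof (intro subset_antisym subsetI)
    fix \<xi> assume "\<xi> \<in> pts E"
    then show "\<xi> \<in> (\<lambda>f. apply_bcontfun f (\<tau>, 0)) ` pts (path_space E)"
      by (intro rev_image_eqI[of "orbit \<xi>"]) (simp_all add: orbit_in_path_space)
  qed (auto simp: path_space_pts[OF banach])
  moreover have "norm \<xi> = Inf (norm ` {f \<in> pts (path_space E). apply_bcontfun f (\<tau>, 0) = \<xi>})"
    if \<xi>: "\<xi> \<in> pts E" for \<xi>
  proof (rule cInf_eq_minimum[symmetric])
    show "norm \<xi> \<in> norm ` {f \<in> pts (path_space E). apply_bcontfun f (\<tau>, 0) = \<xi>}"
      using \<xi> by (intro rev_image_eqI[of "orbit \<xi>"]) (simp_all add: orbit_in_path_space norm_orbit)
  qed (use norm_bounded in blast)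
  ultimately show ?thesis
    unfolding surjective_isometry_def using evaluation_bounded_ops[OF banach] by blast
qed

lemma value_in_pts: "f \<in> pts (path_space E) \<Longrightarrow> apply_bcontfun f p \<in> pts E"
  unfolding path_space_pts[OF banach] by blast

lemma continuous_on_meas:
  assumes "f \<in> pts (path_space E)"
  shows "continuous_on S (\<lambda>\<tau>. meas \<tau> f)"
proof -
  have "continuous_on S (\<lambda>\<tau>. apply_bcontfun f (\<tau>, 0))"
    by (rule continuous_on_compose2[OF continuous_on_apply_bcontfun[of UNIV]])
      (auto intro!: continuous_intros)
  then show ?thesis
    unfolding continuous_on_iff
    by (simp add: meas_def dist_norm norm_orbit_diff value_in_pts[OF assms])
qed

lemma meas_family: "family_of_measurements (path_space E) J meas"
proof -
  have "(\<lambda>f. orbit (apply_bcontfun f (\<tau>, 0))) \<in> bounded_ops (path_space E) (path_space E)" for \<tau>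
    by (rule bounded_ops_comp[OF evaluation_bounded_ops[OF banach] orbit_bounded_ops])
  moreover have "norm (meas \<tau> f) \<le> norm f" if "f \<in> pts (path_space E)" for \<tau> f
    using that by (simp add: meas_def norm_orbit value_in_pts norm_bounded)
  ultimately have "contraction (path_space E) (meas \<tau>)" for \<tau>
    unfolding contraction_def meas_def[abs_def] by blast
  then show ?thesis
    by (simp add: family_of_measurements_def contraction_family_def continuous_on_meas)
      (simp add: meas_def value_in_pts)
qed

text \<open>Translating an orbit and measuring it advances the semigroup. This single identity carries
  both passivity and the comparison of the two products.\<close>

lemma meas_translate_orbit:
  assumes "\<xi> \<in> pts E" "0 \<le> d"
  shows "meas \<tau> (translate d (orbit \<xi>)) = orbit (Z \<tau> d \<xi>)"
  using assms by (simp add: meas_def orbit_apply)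

lemma meas_passivity: "passivity (path_space E) J meas translate"
  unfolding passivity_def
proof (intro ballI allI impI)
  fix \<tau> s t :: real and f assume "0 \<le> s" "0 \<le> t" and f: "f \<in> pts (path_space E)"
  let ?\<xi> = "apply_bcontfun f (\<tau>, 0)"
  have \<xi>: "?\<xi> \<in> pts E" using f by (rule value_in_pts)
  have "meas \<tau> f = orbit ?\<xi>" by (simp add: meas_def)
  moreover have "meas \<tau> (orbit (Z \<tau> t ?\<xi>)) = orbit (Z \<tau> t ?\<xi>)"
    using \<xi> \<open>0 \<le> t\<close> by (simp add: meas_def Z_facts)
  ultimately show "meas \<tau> (translate s (meas \<tau> (meas \<tau> (translate t (meas \<tau> f)))))
      = meas \<tau> (translate (s + t) (meas \<tau> f))"
    using \<xi> \<open>0 \<le> s\<close> \<open>0 \<le> t\<close> by (simp add: meas_translate_orbit Z_facts)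
qed

lemma passively_monitored:
  "self_similar P \<Longrightarrow> passively_monitored_process (path_space E) J P meas translate"
  by (simp add: passively_monitored_process_def path_space_banach banach
      translate_isometric_C0_group meas_family meas_passivity)

section \<open>Comparison of the two products\<close>

text \<open>The first measurement turns a path into an orbit; from then on the monitored dynamics stays on
  orbits and acts there as the evolution products do. So the two products share all factors but the
  first.\<close>

lemma monitoring_prod_eq:
  assumes \<Xi>: "\<Xi> \<in> partitions01" and st: "s \<le> t"
  shows "\<exists>B. contraction E B \<and>
    (\<forall>f\<in>pts (path_space E). monitoring_prod meas translate \<Xi> t s f =
       orbit (B (apply_bcontfun f (tau \<Xi> t s 1, dtau \<Xi> t s 1)))) \<and>
    evolution_prod Z \<Xi> t s = B \<circ> Z (tau \<Xi> t s 1) (dtau \<Xi> t s 1)"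
proof -
  define F where "F k = Z (tau \<Xi> t s k) (dtau \<Xi> t s k)" for k
  define G where "G k = meas (tau \<Xi> t s k) \<circ> translate (dtau \<Xi> t s k)" for k
  define B where "B n = rev_prod (\<lambda>k. F (Suc k)) n" for n
  obtain n where n: "N_part \<Xi> = Suc n"
    using partition01_facts(1)[OF \<Xi>] by (cases "N_part \<Xi>") auto
  have d: "0 \<le> dtau \<Xi> t s k" if "k \<le> Suc n" for k
    using partition01_facts(4)[OF \<Xi> st] that n by simp
  have Bc: "contraction E (B m)" if "m \<le> n" for m
    unfolding B_def F_def using that by (intro rev_prod_contraction Z_facts(1) d) auto
  have "rev_prod G (Suc m) f = orbit (B m (apply_bcontfun f (tau \<Xi> t s 1, dtau \<Xi> t s 1)))"
    if "m \<le> n" and f: "f \<in> pts (path_space E)" for m f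
    using that(1)
  proof (induction m)
    case 0
    show ?case by (simp add: G_def B_def meas_def)
  next
    case (Suc m)
    let ?\<xi> = "B m (apply_bcontfun f (tau \<Xi> t s 1, dtau \<Xi> t s 1))"
    have \<xi>: "?\<xi> \<in> pts E"
      using Bc[of m] Suc.prems value_in_pts[OF f] unfolding contraction_def
      by (auto intro: bounded_ops_facts(1))
    have "rev_prod G (Suc (Suc m)) f = G (Suc (Suc m)) (rev_prod G (Suc m) f)"
      by (simp only: rev_prod.simps comp_apply)
    also have "\<dots> = G (Suc (Suc m)) (orbit ?\<xi>)" using Suc by simp
    also have "\<dots> = orbit (F (Suc (Suc m)) ?\<xi>)"
      unfolding G_def F_def comp_apply by (rule meas_translate_orbit[OF \<xi> d]) (use Suc.prems in simp)
    also have "\<dots> = orbit (B (Suc m) (apply_bcontfun f (tau \<Xi> t s 1, dtau \<Xi> t s 1)))"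
      by (simp add: B_def)
    finally show ?case .
  qed
  then have mon: "\<And>f. f \<in> pts (path_space E) \<Longrightarrow> monitoring_prod meas translate \<Xi> t s f =
      orbit (B n (apply_bcontfun f (tau \<Xi> t s 1, dtau \<Xi> t s 1)))"
    by (simp add: monitoring_prod_def n G_def[abs_def] del: rev_prod.simps)
  have evo: "evolution_prod Z \<Xi> t s = B n \<circ> Z (tau \<Xi> t s 1) (dtau \<Xi> t s 1)"
    unfolding evolution_prod_def n rev_prod_Suc_shift B_def F_def by simp
  show ?thesis using Bc[OF order_refl] mon evo by blast
qed

lemma evolution_prod_contraction:
  assumes "\<Xi> \<in> partitions01" "s \<le> t"
  shows "contraction E (evolution_prod Z \<Xi> t s)"
  unfolding evolution_prod_def
  by (intro rev_prod_contraction Z_facts(1) partition01_facts(4)[OF assms]) auto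

lemma monitoring_prod_orbit:
  assumes "\<Xi> \<in> partitions01" "s \<le> t" and \<xi>: "\<xi> \<in> pts E"
  shows "monitoring_prod meas translate \<Xi> t s (orbit \<xi>) = orbit (evolution_prod Z \<Xi> t s \<xi>)"
proof -
  have "0 \<le> dtau \<Xi> t s 1" using partition01_facts[OF assms(1)] assms(2) by simp
  moreover obtain B where "contraction E B"
    and "\<And>f. f \<in> pts (path_space E) \<Longrightarrow> monitoring_prod meas translate \<Xi> t s f =
           orbit (B (apply_bcontfun f (tau \<Xi> t s 1, dtau \<Xi> t s 1)))"
    and "evolution_prod Z \<Xi> t s = B \<circ> Z (tau \<Xi> t s 1) (dtau \<Xi> t s 1)"
    using monitoring_prod_eq[OF assms(1,2)] by blast
  ultimately show ?thesis by (simp add: orbit_in_path_space orbit_apply \<xi>)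
qed

text \<open>For a general path \<open>f\<close> the products differ by at most the distance between \<open>f\<close> and the orbit
  of \<open>f (s, 0)\<close>, both taken at the first point of the partition. The two agree at \<open>(s, 0)\<close>, and the
  first point tends to it because the first gap shrinks.\<close>

lemma monitoring_prod_deviation:
  assumes P: "self_similar P" and f: "f \<in> pts (path_space E)" and e: "0 < e"
  shows "\<forall>\<^sub>F \<Xi> in refinement P. \<forall>s\<in>{a..b}. \<forall>t\<in>{a..b}. s \<le> t \<longrightarrow>
     norm (monitoring_prod meas translate \<Xi> t s f
         - orbit (evolution_prod Z \<Xi> t s (apply_bcontfun f (s, 0)))) < e"
proof -
  define g where "g q = apply_bcontfun (f - meas (fst q) f) (fst q + snd q, snd q)" for q
  have "continuous_on ({a..b} \<times> {0..1}) (\<lambda>q. meas (fst q) f)"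
    by (rule continuous_on_compose2[OF continuous_on_meas[OF f, of UNIV]]) (auto intro!: continuous_intros)
  then have "continuous_on ({a..b} \<times> {0..1}) g"
    unfolding g_def by (intro continuous_on_apply_bcontfun_joint continuous_intros)
  then have "uniformly_continuous_on ({a..b} \<times> {0..1}) g"
    by (rule compact_uniformly_continuous) (simp add: compact_Times)
  then obtain \<delta> where \<delta>: "\<delta> > 0"
    "\<And>q q'. q \<in> {a..b} \<times> {0..1} \<Longrightarrow> q' \<in> {a..b} \<times> {0..1} \<Longrightarrow> dist q' q < \<delta> \<Longrightarrow> dist (g q') (g q) < e"
    using e unfolding uniformly_continuous_on_def by metis
  have g0: "g (s, 0) = 0" for s
    using value_in_pts[OF f] by (simp add: g_def meas_def)
  have small: "norm (g (s, d)) < e" if "s \<in> {a..b}" "0 \<le> d" "d < min \<delta> 1" for s d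
    using \<delta>(2)[of "(s, 0)" "(s, d)"] that g0[of s] by (simp add: dist_Pair_Pair)
  \<comment> \<open>A relative gap of at most \<open>c\<close> is a time step of at most \<open>w * c\<close>, which is below \<open>min \<delta> 1\<close>; the
    summand \<open>1\<close> in \<open>w\<close> covers a degenerate interval.\<close>
  define w where "w = \<bar>b - a\<bar> + 1"
  have w: "0 < w" by (simp add: w_def)
  define c where "c = min \<delta> 1 / 2 / w"
  have c: "0 < c" using \<delta>(1) w by (simp add: c_def)
  show ?thesis
    using eventually_first_point_small[OF P c]
  proof eventually_elim
    case (elim \<Xi>)
    then have \<Xi>: "\<Xi> \<in> partitions01" using P unfolding self_similar_def by blast
    show ?case
    proof (intro ballI impI)
      fix s t assume s: "s \<in> {a..b}" and t: "t \<in> {a..b}" and st: "s \<le> t"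
      let ?d = "dtau \<Xi> t s 1"
      have tau1: "tau \<Xi> t s 1 = s + ?d"
        using partition01_facts(2)[OF \<Xi>] by (simp add: dtau_def tau_def)
      have d0: "0 \<le> ?d" using partition01_facts(1,4)[OF \<Xi>] st by simp
      have "?d = (t - s) * (sorted_list_of_set \<Xi> ! 1)"
        using partition01_facts(2)[OF \<Xi>] by (simp add: dtau_def tau_def)
      also have "\<dots> \<le> (t - s) * c" using elim st by (intro mult_left_mono) auto
      also have "\<dots> \<le> w * c" using s t c by (intro mult_right_mono) (auto simp: w_def)
      also have "\<dots> = min \<delta> 1 / 2" using w by (simp add: c_def)
      also have "\<dots> < min \<delta> 1" using \<delta>(1) by (simp add: min_def)
      finally have d1: "?d < min \<delta> 1" .
      obtain B where B: "contraction E B"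
        "\<And>f. f \<in> pts (path_space E) \<Longrightarrow> monitoring_prod meas translate \<Xi> t s f =
          orbit (B (apply_bcontfun f (tau \<Xi> t s 1, ?d)))"
        "evolution_prod Z \<Xi> t s = B \<circ> Z (tau \<Xi> t s 1) ?d"
        using monitoring_prod_eq[OF \<Xi> st] by blast
      have Bops: "B \<in> bounded_ops E E" using B(1) by (simp add: contraction_def)
      let ?x = "apply_bcontfun f (tau \<Xi> t s 1, ?d)"
        and ?y = "Z (tau \<Xi> t s 1) ?d (apply_bcontfun f (s, 0))"
      have xy: "?x \<in> pts E" "?y \<in> pts E" using value_in_pts[OF f] d0 Z_facts(3) by blast+
      have "norm (orbit (B ?x) - orbit (B ?y)) = norm (B ?x - B ?y)"
        using xy by (intro norm_orbit_diff bounded_ops_facts(1)[OF Bops])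
      also have "\<dots> = norm (B (?x - ?y))" using bounded_ops_diff[OF banach Bops] xy by simp
      also have "\<dots> \<le> norm (?x - ?y)"
        using B(1) banach_space_facts(3)[OF banach xy] unfolding contraction_def by blast
      also have "?x - ?y = g (s, ?d)"
        unfolding tau1 using d0 value_in_pts[OF f] by (simp add: g_def meas_def orbit_apply)
      also have "norm \<dots> < e" using s d0 d1 by (rule small)
      finally show "norm (monitoring_prod meas translate \<Xi> t s f
         - orbit (evolution_prod Z \<Xi> t s (apply_bcontfun f (s, 0)))) < e"
        by (simp add: B f)
    qed
  qed
qed

section \<open>Comparison of the limits\<close>

text \<open>The limit operator has to be applied to the moving vector \<open>f (s, 0)\<close>; by continuity of \<open>f\<close> and
  compactness of \<open>J\<close> these vectors form a compact set.\<close>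

lemma evolution_to_monitoring_limit:
  assumes P: "self_similar P" and J: "compact J" and L: "evolution_limit E J P Z L"
  shows "monitoring_limit (path_space E) J P meas translate
           (\<lambda>t s f. orbit (L t s (apply_bcontfun f (s, 0))))"
  unfolding monitoring_limit_def kSOT_limit_def
proof (intro conjI allI impI ballI)
  note K = L[unfolded evolution_limit_def]
  have Lops: "L t s \<in> bounded_ops E E" if "(t, s) \<in> Delta J" for t s
    using K that unfolding kSOT_limit_def by blast
  {
    fix p assume "p \<in> Delta J"
    then have "L (fst p) (snd p) \<in> bounded_ops E E" by (intro Lops) simp
    then show "case p of (t, s) \<Rightarrow>
        (\<lambda>f. orbit (L t s (apply_bcontfun f (s, 0)))) \<in> bounded_ops (path_space E) (path_space E)"
      using bounded_ops_comp[OF bounded_ops_comp[OF evaluation_bounded_ops[OF banach]] orbit_bounded_ops]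
      by (simp add: case_prod_beta)
  next
    fix C f assume C: "compact C \<and> C \<subseteq> Delta J" and f: "f \<in> pts (path_space E)"
    have P01: "P \<subseteq> partitions01" using P by (simp add: self_similar_def)
    obtain a b where ab: "J \<subseteq> {a..b}"
      using compact_imp_bounded[OF J] bounded_subset_cbox_symmetric[of J] by (metis cbox_interval)
    define X where "X = (\<lambda>s. apply_bcontfun f (s, 0)) ` J"
    have "continuous_on J (\<lambda>s. apply_bcontfun f (s, 0))"
      by (rule continuous_on_compose2[OF continuous_on_apply_bcontfun[of UNIV]])
        (auto intro!: continuous_intros)
    then have X: "compact X" "X \<subseteq> pts E"
      unfolding X_def using J value_in_pts[OF f] by (auto intro: compact_continuous_image)
    show "uniform_limit C (\<lambda>\<Xi> (t, s). monitoring_prod meas translate \<Xi> t s f)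
        (\<lambda>(t, s). orbit (L t s (apply_bcontfun f (s, 0)))) (refinement P)"
    proof (rule uniform_limitI)
      fix e :: real assume "0 < e"
      then have e: "0 < e / 2" by simp
      have "contraction E (evolution_prod Z \<Xi> t s)" if "\<Xi> \<in> P" "(t, s) \<in> Delta J" for \<Xi> t s
        using evolution_prod_contraction that P01 by (auto simp: Delta_def)
      then have "\<forall>\<^sub>F \<Xi> in refinement P. \<forall>(t, s)\<in>C. \<forall>\<xi>\<in>X.
          norm (evolution_prod Z \<Xi> t s \<xi> - L t s \<xi>) < e / 2"
        using kSOT_limit_uniform_on_compact_vectors[OF banach P K _ _ _ X e] C by blast
      then show "\<forall>\<^sub>F \<Xi> in refinement P. \<forall>p\<in>C.
          dist (case p of (t, s) \<Rightarrow> monitoring_prod meas translate \<Xi> t s f)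
            (case p of (t, s) \<Rightarrow> orbit (L t s (apply_bcontfun f (s, 0)))) < e"
        using monitoring_prod_deviation[OF P f e, of a b] eventually_refinement_mem[OF P]
      proof eventually_elim
        case (elim \<Xi>)
        show ?case
        proof
          fix p assume "p \<in> C"
          then obtain t s where p: "p = (t, s)" "(t, s) \<in> C" "(t, s) \<in> Delta J"
            using C by (cases p) auto
          then have s: "s \<in> J" "s \<in> {a..b}" "t \<in> {a..b}" "s \<le> t" using ab by (auto simp: Delta_def)
          let ?\<xi> = "apply_bcontfun f (s, 0)"
          have \<xi>: "?\<xi> \<in> pts E" "?\<xi> \<in> X" using value_in_pts[OF f] s(1) by (auto simp: X_def)
          have "\<Xi> \<in> partitions01" using elim(3) P01 by blast
          then have "evolution_prod Z \<Xi> t s \<in> bounded_ops E E"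
            using evolution_prod_contraction s(4) by (simp add: contraction_def)
          then have pts: "evolution_prod Z \<Xi> t s ?\<xi> \<in> pts E" "L t s ?\<xi> \<in> pts E"
            using Lops[OF p(3)] \<xi>(1) by (simp_all add: bounded_ops_facts(1))
          have "dist (monitoring_prod meas translate \<Xi> t s f) (orbit (L t s ?\<xi>))
              \<le> norm (monitoring_prod meas translate \<Xi> t s f - orbit (evolution_prod Z \<Xi> t s ?\<xi>))
                + norm (orbit (evolution_prod Z \<Xi> t s ?\<xi>) - orbit (L t s ?\<xi>))"
            by norm
          also have "norm (orbit (evolution_prod Z \<Xi> t s ?\<xi>) - orbit (L t s ?\<xi>))
              = norm (evolution_prod Z \<Xi> t s ?\<xi> - L t s ?\<xi>)"
            using pts by (rule norm_orbit_diff)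
          also have "\<dots> < e / 2" using elim(1) p(2) \<xi>(2) by blast
          also have "norm (monitoring_prod meas translate \<Xi> t s f - orbit (evolution_prod Z \<Xi> t s ?\<xi>)) < e / 2"
            using elim(2) s by blast
          finally show "dist (case p of (t, s) \<Rightarrow> monitoring_prod meas translate \<Xi> t s f)
            (case p of (t, s) \<Rightarrow> orbit (L t s (apply_bcontfun f (s, 0)))) < e"
            by (simp add: p(1))
        qed
      qed
    qed
  }
qed

lemma monitoring_to_evolution_limit:
  assumes P: "self_similar P" and L: "monitoring_limit (path_space E) J P meas translate L"
  shows "evolution_limit E J P Z (\<lambda>t s \<xi>. apply_bcontfun (L t s (orbit \<xi>)) (0, 0))"
  unfolding evolution_limit_def kSOT_limit_def
proof (intro conjI allI impI ballI)
  note K = L[unfolded monitoring_limit_def kSOT_limit_def]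
  {
    fix p assume "p \<in> Delta J"
    then have "L (fst p) (snd p) \<in> bounded_ops (path_space E) (path_space E)"
      using K by (auto simp: case_prod_beta)
    then show "case p of (t, s) \<Rightarrow> (\<lambda>\<xi>. apply_bcontfun (L t s (orbit \<xi>)) (0, 0)) \<in> bounded_ops E E"
      using bounded_ops_comp[OF bounded_ops_comp[OF orbit_bounded_ops] evaluation_bounded_ops[OF banach]]
      by (simp add: case_prod_beta)
  next
    fix C \<xi> assume C: "compact C \<and> C \<subseteq> Delta J" and \<xi>: "\<xi> \<in> pts E"
    have "uniform_limit C (\<lambda>\<Xi> (t, s). monitoring_prod meas translate \<Xi> t s (orbit \<xi>))
        (\<lambda>(t, s). L t s (orbit \<xi>)) (refinement P)"
      using K C orbit_in_path_space[OF \<xi>] by blast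
    note lim = uniform_limitD[OF this]
    show "uniform_limit C (\<lambda>\<Xi> (t, s). evolution_prod Z \<Xi> t s \<xi>)
        (\<lambda>(t, s). apply_bcontfun (L t s (orbit \<xi>)) (0, 0)) (refinement P)"
    proof (rule uniform_limitI)
      fix e :: real assume "0 < e"
      from lim[OF this] eventually_refinement_mem[OF P]
      show "\<forall>\<^sub>F \<Xi> in refinement P. \<forall>p\<in>C. dist (case p of (t, s) \<Rightarrow> evolution_prod Z \<Xi> t s \<xi>)
          (case p of (t, s) \<Rightarrow> apply_bcontfun (L t s (orbit \<xi>)) (0, 0)) < e"
      proof eventually_elim
        case (elim \<Xi>)
        show ?case
        proof
          fix p assume p: "p \<in> C"
          obtain t s where ts: "p = (t, s)" "s \<le> t" using p C by (cases p) (auto simp: Delta_def)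
          have \<Xi>: "\<Xi> \<in> partitions01" using elim(2) P by (auto simp: self_similar_def)
          have "evolution_prod Z \<Xi> t s \<xi> \<in> pts E"
            using evolution_prod_contraction[OF \<Xi> ts(2)] \<xi>
            by (auto simp: contraction_def bounded_ops_facts(1))
          then have "evolution_prod Z \<Xi> t s \<xi>
              = apply_bcontfun (monitoring_prod meas translate \<Xi> t s (orbit \<xi>)) (0, 0)"
            by (simp add: monitoring_prod_orbit[OF \<Xi> ts(2) \<xi>])
          moreover have "dist (monitoring_prod meas translate \<Xi> t s (orbit \<xi>)) (L t s (orbit \<xi>)) < e"
            using elim(1) p ts(1) by auto
          ultimately show "dist (case p of (t, s) \<Rightarrow> evolution_prod Z \<Xi> t s \<xi>)
              (case p of (t, s) \<Rightarrow> apply_bcontfun (L t s (orbit \<xi>)) (0, 0)) < e"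
            by (simp add: ts(1) dist_fun_lt_imp_dist_val_lt)
        qed
      qed
    qed
  }
qed

end

section \<open>Indexed semigroups over a compact interval\<close>

text \<open>Uniform convergence on the compact time interval \<open>[0, x + 1]\<close>, a neighbourhood of \<open>x\<close>, lets the
  index and the time be moved one after the other.\<close>

lemma kSOT_index_continuous_joint:
  assumes T: "\<And>\<tau>. \<tau> \<in> J \<Longrightarrow> contractive_C0_semigroup E (T \<tau>)"
    and cont: "kSOT_index_continuous E J T" and \<xi>: "\<xi> \<in> pts E"
  shows "continuous_on (J \<times> {0..}) (\<lambda>p. T (fst p) (snd p) \<xi>)"
  unfolding continuous_on_iff
proof (intro ballI allI impI)
  fix p :: "real \<times> real" and e :: real assume p: "p \<in> J \<times> {0..}" and "0 < e"
  then have e: "0 < e / 2" by simp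
  obtain \<tau> x where \<tau>: "p = (\<tau>, x)" "\<tau> \<in> J" "0 \<le> x" using p by auto
  have "uniform_limit {0..x + 1} (\<lambda>\<tau> t. T \<tau> t \<xi>) (\<lambda>t. T \<tau> t \<xi>) (at \<tau> within J)"
    using cont \<tau>(2) \<xi> unfolding kSOT_index_continuous_def
    by (metis compact_Icc Icc_subset_Ici_iff order_refl)
  from uniform_limitD[OF this e] obtain d1 where d1: "0 < d1"
    "\<And>\<sigma> t. \<sigma> \<in> J \<Longrightarrow> \<sigma> \<noteq> \<tau> \<Longrightarrow> dist \<sigma> \<tau> < d1 \<Longrightarrow> t \<in> {0..x + 1} \<Longrightarrow> dist (T \<sigma> t \<xi>) (T \<tau> t \<xi>) < e / 2"
    unfolding eventually_at by blast
  have "continuous_on {0..} (\<lambda>t. T \<tau> t \<xi>)"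
    using T[OF \<tau>(2)] \<xi> unfolding contractive_C0_semigroup_def by blast
  then obtain d2 where d2: "0 < d2"
    "\<And>t. t \<in> {0..} \<Longrightarrow> dist t x < d2 \<Longrightarrow> dist (T \<tau> t \<xi>) (T \<tau> x \<xi>) < e / 2"
    using \<tau>(3) e unfolding continuous_on_iff by (metis atLeast_iff)
  have "dist (T (fst q) (snd q) \<xi>) (T (fst p) (snd p) \<xi>) < e"
    if q: "q \<in> J \<times> {0..}" "dist q p < min (min d1 d2) 1" for q
  proof -
    obtain \<sigma> t where \<sigma>: "q = (\<sigma>, t)" "\<sigma> \<in> J" "0 \<le> t" using q(1) by auto
    have d: "dist \<sigma> \<tau> < min (min d1 d2) 1" "dist t x < min (min d1 d2) 1"
      using dist_fst_le[of q p] dist_snd_le[of q p] q(2) by (simp_all add: \<sigma> \<tau>)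
    then have "t \<in> {0..x + 1}" using \<sigma>(3) by (auto simp: dist_real_def)
    then have "dist (T \<sigma> t \<xi>) (T \<tau> t \<xi>) < e / 2"
      using d1(2)[OF \<sigma>(2)] d e by (cases "\<sigma> = \<tau>") auto
    moreover have "dist (T \<tau> t \<xi>) (T \<tau> x \<xi>) < e / 2" using d2(2) d \<sigma>(3) by auto
    ultimately show ?thesis
      using dist_triangle[of "T \<sigma> t \<xi>" "T \<tau> x \<xi>" "T \<tau> t \<xi>"] by (simp add: \<sigma> \<tau>)
  qed
  then show "\<exists>d>0. \<forall>q\<in>J \<times> {0..}. dist q p < d \<longrightarrow>
      dist (T (fst q) (snd q) \<xi>) (T (fst p) (snd p) \<xi>) < e"
    using d1(1) d2(1) by (intro exI[of _ "min (min d1 d2) 1"]) auto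
qed

text \<open>The paths are indexed by the whole real line, so the family is continued constantly beyond the
  endpoints of \<open>J\<close>; over the empty set the identity semigroup serves.\<close>

lemma extend_to_semigroup_family:
  assumes J: "connected J" "compact J" and pre: "pre_evolution E J P T"
    and cont: "kSOT_index_continuous E J T"
  obtains Z where "semigroup_family E Z" and "\<forall>\<tau>\<in>J. Z \<tau> = T \<tau>"
proof -
  have E: "banach_space E" and T: "\<And>\<tau>. \<tau> \<in> J \<Longrightarrow> contractive_C0_semigroup E (T \<tau>)"
    using pre by (auto simp: pre_evolution_def)
  obtain a b where ab: "J = {a..b}" using J connected_compact_interval_1 by blast
  show ?thesis
  proof (cases "J = {}")
    case True
    have "id \<in> bounded_ops E E" unfolding bounded_ops_def by (auto intro: exI[of _ 1])
    then have "contractive_C0_semigroup E (\<lambda>t. id)"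
      by (simp add: contractive_C0_semigroup_def contraction_def)
    then have "semigroup_family E (\<lambda>\<tau> t. id)"
      using E by unfold_locales (auto intro: exI[of _ 1])
    then show ?thesis using True that by blast
  next
    case False
    define cl where "cl \<tau> = max a (min b \<tau>)" for \<tau>
    have cl: "cl \<tau> \<in> J" "\<tau> \<in> J \<Longrightarrow> cl \<tau> = \<tau>" for \<tau> using False by (auto simp: cl_def ab)
    have "semigroup_family E (\<lambda>\<tau>. T (cl \<tau>))"
    proof
      fix \<xi> assume \<xi>: "\<xi> \<in> pts E"
      note joint = kSOT_index_continuous_joint[OF T cont \<xi>]
      have "continuous_on (UNIV \<times> {0..}) (\<lambda>p :: real \<times> real. T (fst (cl (fst p), snd p)) (snd (cl (fst p), snd p)) \<xi>)"
        by (rule continuous_on_compose2[OF joint])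
          (use cl in \<open>auto simp: cl_def intro!: continuous_intros\<close>)
      then show "continuous_on (UNIV \<times> {0..}) (\<lambda>p. T (cl (fst p)) (snd p) \<xi>)" by simp
      fix e :: real assume "0 < e"
      have "continuous_on (J \<times> {0..1}) (\<lambda>p. T (fst p) (snd p) \<xi>)"
        by (rule continuous_on_subset[OF joint]) auto
      then have "uniformly_continuous_on (J \<times> {0..1}) (\<lambda>p. T (fst p) (snd p) \<xi>)"
        by (rule compact_uniformly_continuous) (simp add: J compact_Times)
      then obtain \<delta> where \<delta>: "\<delta> > 0"
        "\<And>q q'. q \<in> J \<times> {0..1} \<Longrightarrow> q' \<in> J \<times> {0..1} \<Longrightarrow> dist q' q < \<delta> \<Longrightarrow>
           dist (T (fst q') (snd q') \<xi>) (T (fst q) (snd q) \<xi>) < e"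
        using \<open>0 < e\<close> unfolding uniformly_continuous_on_def by metis
      have "norm (T (cl \<tau>) d \<xi> - \<xi>) < e" if "0 \<le> d" "d < min \<delta> 1" for \<tau> d
      proof -
        have "T (cl \<tau>) 0 \<xi> = \<xi>"
          using T[OF cl(1)] \<xi> unfolding contractive_C0_semigroup_def by blast
        then show ?thesis
          using \<delta>(2)[of "(cl \<tau>, 0)" "(cl \<tau>, d)"] cl(1) that by (simp add: dist_Pair_Pair dist_norm)
      qed
      then show "\<exists>\<delta>>0. \<forall>\<tau> d. 0 \<le> d \<and> d < \<delta> \<longrightarrow> norm (T (cl \<tau>) d \<xi> - \<xi>) < e"
        using \<delta>(1) by (intro exI[of _ "min \<delta> 1"]) auto
    qed (use E T cl in auto)
    then show ?thesis by (rule that) (simp add: cl)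
  qed
qed

lemma evolution_limit_cong:
  assumes P: "self_similar P" and J: "connected J" and ZT: "\<forall>\<tau>\<in>J. Z \<tau> = T \<tau>"
  shows "evolution_limit E J P Z L \<longleftrightarrow> evolution_limit E J P T L"
proof -
  have eq: "evolution_prod Z \<Xi> t s = evolution_prod T \<Xi> t s" if "\<Xi> \<in> P" "(t, s) \<in> Delta J" for \<Xi> t s
  proof -
    have \<Xi>: "\<Xi> \<in> partitions01" using that(1) P by (auto simp: self_similar_def)
    have st: "s \<in> J" "t \<in> J" "s \<le> t" using that(2) by (auto simp: Delta_def)
    have "tau \<Xi> t s k \<in> J" if "k \<le> N_part \<Xi>" for k
      using partition01_facts(3)[OF \<Xi> st(3) that] connectedD_interval[OF J st(1,2)] by blast
    then show ?thesis unfolding evolution_prod_def by (intro rev_prod_cong) (simp add: ZT)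
  qed
  have "uniform_limit C (\<lambda>\<Xi> (t, s). evolution_prod Z \<Xi> t s \<xi>) (\<lambda>(t, s). L t s \<xi>) (refinement P)
      \<longleftrightarrow> uniform_limit C (\<lambda>\<Xi> (t, s). evolution_prod T \<Xi> t s \<xi>) (\<lambda>(t, s). L t s \<xi>) (refinement P)"
    if "C \<subseteq> Delta J" for C \<xi>
    by (rule uniform_limit_cong[OF eventually_mono[OF eventually_refinement_mem[OF P]]])
      (use that in \<open>auto simp: eq subset_eq\<close>)
  then show ?thesis unfolding evolution_limit_def kSOT_limit_def by blast
qed

theorem lemma7p11:
  fixes E :: "('k::real_normed_field, 'v::real_normed_vector) nspace"
    and J :: "real set" and P :: "real set set"
    and T :: "real \<Rightarrow> real \<Rightarrow> 'v \<Rightarrow> 'v"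
  assumes "connected J"
    and "pre_evolution E J P T"
    and "kSOT_index_continuous E J T"
    and "compact J"
  shows "\<exists>(E' :: ('k, (real \<times> real) \<Rightarrow>\<^sub>C 'v) nspace) M U.
     passively_monitored_process E' J P M U \<and>
     (evolution_solvable E J P T \<longleftrightarrow> monitoring_solvable E' J P M U) \<and>
     (\<exists>r j js.
        isometric_embedding E E' r \<and>
        surjective_isometry E' E j \<and> (\<forall>s\<in>J. surjective_isometry E' E (js s)) \<and>
        (\<forall>\<xi>\<in>pts E. j (r \<xi>) = \<xi>) \<and> (\<forall>s\<in>J. \<forall>\<xi>\<in>pts E. js s (r \<xi>) = \<xi>) \<and>
        (\<forall>L L'. evolution_limit E J P T L \<and> monitoring_limit E' J P M U L' \<longrightarrow>
           (\<forall>(t, s)\<in>Delta J.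
              (\<forall>\<xi>\<in>pts E. L t s \<xi> = j (L' t s (r \<xi>))) \<and>
              (\<forall>\<eta>\<in>pts E'. L' t s \<eta> = r (L t s (js s \<eta>))))))"
proof -
  have P: "self_similar P" using assms(2) by (simp add: pre_evolution_def)
  obtain Z where Z: "semigroup_family E Z" and ZT: "\<forall>\<tau>\<in>J. Z \<tau> = T \<tau>"
    using extend_to_semigroup_family[OF assms(1,4,2,3)] .
  interpret semigroup_family E Z by (rule Z)
  let ?E = "path_space E"
  note cong = evolution_limit_cong[OF P assms(1) ZT]
  have to_mon: "monitoring_limit ?E J P meas translate (\<lambda>t s f. orbit (L t s (apply_bcontfun f (s, 0))))"
    if "evolution_limit E J P T L" for L
    using evolution_to_monitoring_limit[OF P assms(4)] that cong by blast
  have to_evo: "evolution_solvable E J P T" if "monitoring_solvable ?E J P meas translate"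
    using monitoring_to_evolution_limit[OF P] that cong
    unfolding monitoring_solvable_def evolution_solvable_def by blast
  have formula: "L' t s f = orbit (L t s (apply_bcontfun f (s, 0)))"
    if "evolution_limit E J P T L" "monitoring_limit ?E J P meas translate L'"
      "(t, s) \<in> Delta J" "f \<in> pts ?E" for L L' t s f
    using kSOT_limit_unique[OF P _ _ that(3,4)] to_mon[OF that(1)] that(2)
    unfolding monitoring_limit_def by blast
  have formula': "L t s \<xi> = apply_bcontfun (L' t s (orbit \<xi>)) (0, 0)"
    if L: "evolution_limit E J P T L" and L': "monitoring_limit ?E J P meas translate L'"
      and ts: "(t, s) \<in> Delta J" and \<xi>: "\<xi> \<in> pts E" for L L' t s \<xi>
  proof -
    have "L t s \<in> bounded_ops E E"
      using L ts unfolding evolution_limit_def kSOT_limit_def by blast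
    then have "L t s \<xi> \<in> pts E" using \<xi> by (rule bounded_ops_facts(1))
    then show ?thesis
      using formula[OF L L' ts orbit_in_path_space[OF \<xi>]] \<xi> by simp
  qed
  show ?thesis
  proof (intro exI conjI)
    show "passively_monitored_process ?E J P meas translate" by (rule passively_monitored[OF P])
    show "evolution_solvable E J P T \<longleftrightarrow> monitoring_solvable ?E J P meas translate"
      using to_mon to_evo unfolding monitoring_solvable_def evolution_solvable_def by blast
    show "isometric_embedding E ?E orbit" by (rule orbit_isometric)
    show "surjective_isometry ?E E (\<lambda>f. apply_bcontfun f (0, 0))"
      by (rule evaluation_surjective_isometry)
    show "\<forall>s\<in>J. surjective_isometry ?E E ((\<lambda>s f. apply_bcontfun f (s, 0)) s)"
      by (simp add: evaluation_surjective_isometry)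
  qed (use formula formula' in auto)
qed

end
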